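(* Let $\mathfrak n$ be a $7$-dimensional nilpotent Lie algebra whose dual has a basis $\{e^1,\dots,e^7\}$ with $de^1=de^2=de^3=de^4=0$ and $$de^5=\epsilon_1\sigma_1^-,\qquad de^6=\epsilon_2\sigma_2^-,\qquad de^7=\epsilon_3\sigma_3^-,\qquad \epsilon_i\in\mathbb R.$$ Consider on $\mathfrak n$ the $\mathrm{SO}(3)$-family of $\mathrm G_2$-structures $$\varphi=\sigma_1^+\wedge E^5+\sigma_2^+\wedge E^6+\sigma_3^+\wedge E^7+E^5\wedge E^6\wedge E^7,\qquad (E^5,E^6,E^7)^T=\mathbf B\,(e^5,e^6,e^7)^T,\ \mathbf B\in\mathrm{SO}(3),$$ together with the connection $A=Y_5e^5+Y_6e^6+Y_7e^7$ with gauge group $G$. Then $A$ is a $\mathrm G_2$-instanton with respect to $\varphi$ if and only if $G$ is abelian, in which case $\varphi$ is purely co-closed (for any $\mathbf B\in\mathrm{SO}(3)$). Moreover, for each of the signatures positive definite, mixed $(1,2)$, and mixed $(2,1)$, there exists an $\mathrm{ad}$-invariant pairing $\langle\cdot,\cdot\rangle$ on $\mathfrak g$ with the prescribed signature such that the curvature $F_A$ of the connection $A=Y_5e^5+Y_6e^6+Y_7e^7$ with $G$ abelian satisfies the heterotic Bianchi identity $dT_\varphi=\langle F_A\wedge F_A\rangle$. In particular, this yields solutions $(\varphi,A)$ to the heterotic $\mathrm G_2$-system.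
   Context: Write $e^{ij}=e^i\wedge e^j$ and $\sigma_1^+=e^{13}-e^{24}$, $\sigma_2^+=-e^{14}-e^{23}$, $\sigma_3^+=e^{12}+e^{34}$; $\sigma_1^-=e^{13}+e^{24}$, $\sigma_2^-=e^{14}-e^{23}$, $\sigma_3^-=e^{12}-e^{34}$. All forms are viewed as left-invariant forms on the simply connected Lie group $N$ with Lie algebra $\mathfrak n$. Connection. $G$ is a $3$-dimensional real Lie group with reductive Lie algebra $\mathfrak g$ (so $\mathfrak g$ is $\mathbb R^3$, $\mathfrak{su}(2)$ or $\mathfrak{sl}(2,\mathbb R)$), and $\{Y_5,Y_6,Y_7\}$ is a basis of $\mathfrak g$ with $[Y_6,Y_7]=\lambda_5Y_5$, $[Y_7,Y_5]=\lambda_6Y_6$, $[Y_5,Y_6]=\lambda_7Y_7$, $\lambda_i\in\mathbb R$; $A$ is a connection on the trivial $G$-bundle over $N$, with curvature $F_A=dA+\frac12[A\wedge A]$. $\mathrm G_2$ notions. A $\mathrm G_2$-structure $\varphi$ determines $g_\varphi,\mathrm{vol}_\varphi$ by $6g_\varphi(X,Y)\mathrm{vol}_\varphi=(X\lrcorner\varphi)\wedge(Y\lrcorner\varphi)\wedge\varphi$, and Hodge star $\star$. Put $\psi=\star\varphi$, $\tau_0=\frac17\star(d\varphi\wedge\varphi)$, $\tau_1=\frac1{12}\star(\varphi\wedge\star d\varphi)$, $T_\varphi=\frac16\star(d\varphi\wedge\varphi)\varphi-\star d\varphi+\star(4\tau_1\wedge\varphi)$. $\varphi$ is co-closed if $d\psi=0$,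 and purely co-closed if in addition $\tau_0=0$. $A$ is a $\mathrm G_2$-instanton if $F_A\wedge\psi=0$. The heterotic $\mathrm G_2$-system is: $d\psi=4\tau_1\wedge\psi$, $F_A\wedge\psi=0$, $dT_\varphi=\langle F_A\wedge F_A\rangle$, where the pairing is a non-degenerate symmetric $\mathrm{ad}$-invariant bilinear form on $\mathfrak g$. *)

theory Defs
  imports "HOL-Analysis.Analysis" "HOL-Library.Function_Algebras"
begin

section \<open>Pointwise real vector space structure on functions\<close>

instantiation "fun" :: (type, real_vector) real_vector
begin

definition scaleR_fun :: "real \<Rightarrow> ('a \<Rightarrow> 'b) \<Rightarrow> 'a \<Rightarrow> 'b" where
  "scaleR_fun c f = (\<lambda>x. c *\<^sub>R f x)"

instance
  by standard (simp_all add: scaleR_fun_def fun_eq_iff scaleR_add_right scaleR_add_left)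

end

lemma scaleR_fun_apply [simp]: "(c *\<^sub>R f) x = c *\<^sub>R f x"
  by (simp add: scaleR_fun_def)


section \<open>Real Lie algebras\<close>

definition lie_algebra :: "('v::real_vector \<Rightarrow> 'v \<Rightarrow> 'v) \<Rightarrow> bool" where
  "lie_algebra br \<longleftrightarrow> bilinear br \<and> (\<forall>x. br x x = 0) \<and>
     (\<forall>x y z. br x (br y z) + br y (br z x) + br z (br x y) = 0)"

primrec lower_central :: "('v::real_vector \<Rightarrow> 'v \<Rightarrow> 'v) \<Rightarrow> nat \<Rightarrow> 'v set" where
  "lower_central br 0 = UNIV"
| "lower_central br (Suc k) = span {br x y | x y. y \<in> lower_central br k}"

definition nilpotent_lie :: "('v::real_vector \<Rightarrow> 'v \<Rightarrow> 'v) \<Rightarrow> bool" where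
  "nilpotent_lie br \<longleftrightarrow> (\<exists>k. lower_central br k = {0})"

definition abelian_lie :: "('v::real_vector \<Rightarrow> 'v \<Rightarrow> 'v) \<Rightarrow> bool" where
  "abelian_lie br \<longleftrightarrow> (\<forall>x y. br x y = 0)"

definition lie_ideal :: "('v::real_vector \<Rightarrow> 'v \<Rightarrow> 'v) \<Rightarrow> 'v set \<Rightarrow> bool" where
  "lie_ideal br I \<longleftrightarrow> subspace I \<and> (\<forall>x. \<forall>y\<in>I. br x y \<in> I)"

definition reductive_lie :: "('v::real_vector \<Rightarrow> 'v \<Rightarrow> 'v) \<Rightarrow> bool" where
  "reductive_lie br \<longleftrightarrow> (\<forall>I. lie_ideal br I \<longrightarrow>
     (\<exists>J. lie_ideal br J \<and> I \<inter> J = {0} \<and> (\<forall>x. \<exists>y\<in>I. \<exists>z\<in>J. x = y + z)))"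

definition invariant_pairing ::
    "('v::real_vector \<Rightarrow> 'v \<Rightarrow> 'v) \<Rightarrow> ('v \<Rightarrow> 'v \<Rightarrow> real) \<Rightarrow> bool" where
  "invariant_pairing br K \<longleftrightarrow> bilinear K \<and> (\<forall>x y. K x y = K y x) \<and>
     (\<forall>x. (\<forall>y. K x y = 0) \<longrightarrow> x = 0) \<and>
     (\<forall>x y z. K (br x y) z + K y (br x z) = 0)"

text \<open>\<open>p\<close> positive and \<open>q\<close> negative directions, and no null ones.\<close>

definition has_signature :: "('v::real_vector \<Rightarrow> 'v \<Rightarrow> real) \<Rightarrow> nat \<Rightarrow> nat \<Rightarrow> bool" where
  "has_signature K p q \<longleftrightarrow> (\<exists>P N. finite P \<and> finite N \<and> P \<inter> N = {} \<and> card P = p \<and> card N = q \<and>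
     independent (P \<union> N) \<and> span (P \<union> N) = UNIV \<and>
     (\<forall>x\<in>P. K x x > 0) \<and> (\<forall>x\<in>N. K x x < 0) \<and>
     (\<forall>x\<in>P \<union> N. \<forall>y\<in>P \<union> N. x \<noteq> y \<longrightarrow> K x y = 0))"


section \<open>Exterior forms and the Chevalley-Eilenberg differential\<close>

text \<open>
  A form eats a list of vectors. A \<open>k\<close>-form vanishes on all lists whose length is not \<open>k\<close>, so a
  function on lists is a (possibly inhomogeneous) form, and the operations below need no degree
  arguments. A \<open>0\<close>-form is a number, namely its value on the empty list.

  When the vectors are the elements of the Lie algebra \<open>\<nn>\<close> of a simply connected Lie group \<open>N\<close>,
  these are exactly the left-invariant forms on \<open>N\<close>.
\<close>

type_synonym ('v, 'b) form = "'v list \<Rightarrow> 'b"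

definition forms :: "nat \<Rightarrow> ('v::real_vector, real) form set" where
  "forms k = {\<omega>. (\<forall>xs. length xs \<noteq> k \<longrightarrow> \<omega> xs = 0) \<and>
     (\<forall>xs ys. length xs + length ys + 1 = k \<longrightarrow> linear (\<lambda>x. \<omega> (xs @ x # ys))) \<and>
     (\<forall>xs. length xs = k \<longrightarrow> \<not> distinct xs \<longrightarrow> \<omega> xs = 0)}"

text \<open>
  The sign of the permutation that sends \<open>0, 1, \<dots>, n - 1\<close> to the elements of \<open>I\<close> followed by those
  of its complement, both in increasing order.
\<close>

definition shuffle_sign :: "nat set \<Rightarrow> nat \<Rightarrow> real" where
  "shuffle_sign I n = (- 1) ^ card {(i, j). i \<in> I \<and> j \<in> {..<n} - I \<and> j < i}"

text \<open>
  Wedge product of vector-valued forms, the values being multiplied by the bilinear map \<open>m\<close>. The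
  normalisation is \<open>(\<alpha> \<and> \<beta>)(x, y) = m (\<alpha> x) (\<beta> y) - m (\<alpha> y) (\<beta> x)\<close> for \<open>1\<close>-forms.
\<close>

definition wedge_by :: "('b \<Rightarrow> 'c \<Rightarrow> 'd::real_vector) \<Rightarrow>
    ('v, 'b) form \<Rightarrow> ('v, 'c) form \<Rightarrow> ('v, 'd) form" where
  "wedge_by m \<alpha> \<beta> = (\<lambda>xs. \<Sum>I\<in>Pow {..<length xs}.
     shuffle_sign I (length xs) *\<^sub>R m (\<alpha> (nths xs I)) (\<beta> (nths xs (- I))))"

abbreviation wedge :: "('v, real) form \<Rightarrow> ('v, real) form \<Rightarrow> ('v, real) form"
    (infixr "\<^bold>\<and>" 76) where
  "\<alpha> \<^bold>\<and> \<beta> \<equiv> wedge_by (*) \<alpha> \<beta>"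

definition interior :: "'v \<Rightarrow> ('v, 'b) form \<Rightarrow> ('v, 'b) form" where
  "interior x \<omega> = (\<lambda>xs. \<omega> (x # xs))"

text \<open>
  The exterior derivative of left-invariant forms; on \<open>1\<close>-forms \<open>d\<omega>(x, y) = - \<omega> [x, y]\<close>.
\<close>

definition ext_d :: "('v \<Rightarrow> 'v \<Rightarrow> 'v) \<Rightarrow> ('v, 'b::real_vector) form \<Rightarrow> ('v, 'b) form" where
  "ext_d br \<omega> = (\<lambda>xs. \<Sum>(i, j) | i < j \<and> j < length xs.
     (- 1) ^ (i + j) *\<^sub>R \<omega> (br (xs ! i) (xs ! j) # nths xs (- {i, j})))"


section \<open>Metrics and the Hodge star\<close>

definition inner_product :: "('v::real_vector \<Rightarrow> 'v \<Rightarrow> real) \<Rightarrow> bool" where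
  "inner_product g \<longleftrightarrow> bilinear g \<and> (\<forall>x y. g x y = g y x) \<and> (\<forall>x. x \<noteq> 0 \<longrightarrow> g x x > 0)"

definition orthonormal_basis :: "('v::real_vector \<Rightarrow> 'v \<Rightarrow> real) \<Rightarrow> 'v set \<Rightarrow> bool" where
  "orthonormal_basis g F \<longleftrightarrow> span F = UNIV \<and>
     (\<forall>x\<in>F. \<forall>y\<in>F. g x y = (if x = y then 1 else 0))"

text \<open>\<open>vol\<close> is one of the two Riemannian volume forms (one for each orientation) of \<open>g\<close>.\<close>

definition volume_form :: "('v::real_vector \<Rightarrow> 'v \<Rightarrow> real) \<Rightarrow> ('v, real) form \<Rightarrow> bool" where
  "volume_form g vol \<longleftrightarrow> vol \<in> forms (dim (UNIV :: 'v set)) \<and>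
     (\<forall>fs. distinct fs \<and> orthonormal_basis g (set fs) \<longrightarrow> \<bar>vol fs\<bar> = 1)"

text \<open>
  In index notation \<open>(\<star>\<beta>)\<^sub>b\<^sub>.\<^sub>.\<^sub>. = 1/k! \<beta>\<^sup>a\<^sup>.\<^sup>.\<^sup>. vol\<^sub>a\<^sub>.\<^sub>.\<^sub>.\<^sub>b\<^sub>.\<^sub>.\<^sub>.\<close> for a \<open>k\<close>-form \<open>\<beta>\<close>, the contraction being
  computed in an orthonormal basis, on whose choice it does not depend. This is the operator with
  \<open>\<alpha> \<and> \<star>\<beta> = \<langle>\<alpha>, \<beta>\<rangle> vol\<close>.
\<close>

definition hodge_star :: "('v::real_vector \<Rightarrow> 'v \<Rightarrow> real) \<Rightarrow> ('v, real) form \<Rightarrow>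
    ('v, real) form \<Rightarrow> ('v, real) form" where
  "hodge_star g vol \<beta> = (\<lambda>xs.
     let k = dim (UNIV :: 'v set) - length xs; F = (SOME F. orthonormal_basis g F)
     in (1 / fact k) * (\<Sum>fs | length fs = k \<and> set fs \<subseteq> F. \<beta> fs * vol (fs @ xs)))"


section \<open>\<open>G\<^sub>2\<close>-structures\<close>

definition induces_metric :: "('v::real_vector, real) form \<Rightarrow> ('v \<Rightarrow> 'v \<Rightarrow> real) \<Rightarrow>
    ('v, real) form \<Rightarrow> bool" where
  "induces_metric \<phi> g vol \<longleftrightarrow> inner_product g \<and> volume_form g vol \<and>
     (\<forall>x y. (6 * g x y) *\<^sub>R vol = interior x \<phi> \<^bold>\<and> interior y \<phi> \<^bold>\<and> \<phi>)"

definition g2_structure :: "('v::real_vector, real) form \<Rightarrow> bool" where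
  "g2_structure \<phi> \<longleftrightarrow> dim (UNIV :: 'v set) = 7 \<and> \<phi> \<in> forms 3 \<and> (\<exists>g vol. induces_metric \<phi> g vol)"

definition g2_metric :: "('v::real_vector, real) form \<Rightarrow> 'v \<Rightarrow> 'v \<Rightarrow> real" where
  "g2_metric \<phi> = (THE g. \<exists>vol. induces_metric \<phi> g vol)"

definition g2_vol :: "('v::real_vector, real) form \<Rightarrow> ('v, real) form" where
  "g2_vol \<phi> = (THE vol. \<exists>g. induces_metric \<phi> g vol)"

definition g2_star :: "('v::real_vector, real) form \<Rightarrow> ('v, real) form \<Rightarrow> ('v, real) form" where
  "g2_star \<phi> = hodge_star (g2_metric \<phi>) (g2_vol \<phi>)"

definition g2_psi :: "('v::real_vector, real) form \<Rightarrow> ('v, real) form" where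
  "g2_psi \<phi> = g2_star \<phi> \<phi>"

definition tau0 :: "('v::real_vector \<Rightarrow> 'v \<Rightarrow> 'v) \<Rightarrow> ('v, real) form \<Rightarrow> real" where
  "tau0 br \<phi> = (1 / 7) * g2_star \<phi> (ext_d br \<phi> \<^bold>\<and> \<phi>) []"

definition tau1 :: "('v::real_vector \<Rightarrow> 'v \<Rightarrow> 'v) \<Rightarrow> ('v, real) form \<Rightarrow> ('v, real) form" where
  "tau1 br \<phi> = (1 / 12) *\<^sub>R g2_star \<phi> (\<phi> \<^bold>\<and> g2_star \<phi> (ext_d br \<phi>))"

definition g2_torsion :: "('v::real_vector \<Rightarrow> 'v \<Rightarrow> 'v) \<Rightarrow> ('v, real) form \<Rightarrow> ('v, real) form" where
  "g2_torsion br \<phi> = ((1 / 6) * g2_star \<phi> (ext_d br \<phi> \<^bold>\<and> \<phi>) []) *\<^sub>R \<phi>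
     - g2_star \<phi> (ext_d br \<phi>) + g2_star \<phi> ((4 *\<^sub>R tau1 br \<phi>) \<^bold>\<and> \<phi>)"

definition co_closed :: "('v::real_vector \<Rightarrow> 'v \<Rightarrow> 'v) \<Rightarrow> ('v, real) form \<Rightarrow> bool" where
  "co_closed br \<phi> \<longleftrightarrow> ext_d br (g2_psi \<phi>) = 0"

definition purely_co_closed :: "('v::real_vector \<Rightarrow> 'v \<Rightarrow> 'v) \<Rightarrow> ('v, real) form \<Rightarrow> bool" where
  "purely_co_closed br \<phi> \<longleftrightarrow> co_closed br \<phi> \<and> tau0 br \<phi> = 0"


section \<open>Connections and the heterotic \<open>G\<^sub>2\<close>-system\<close>

text \<open>
  A left-invariant connection on the trivial \<open>G\<close>-bundle over \<open>N\<close> is a \<open>\<gg>\<close>-valued \<open>1\<close>-form \<open>A\<close> on \<open>\<nn>\<close>.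
  The bracket of \<open>\<nn>\<close> is \<open>br\<close> and that of \<open>\<gg>\<close> is \<open>lb\<close>.
\<close>

definition curvature :: "('v::real_vector \<Rightarrow> 'v \<Rightarrow> 'v) \<Rightarrow> ('g::real_vector \<Rightarrow> 'g \<Rightarrow> 'g) \<Rightarrow>
    ('v, 'g) form \<Rightarrow> ('v, 'g) form" where
  "curvature br lb A = ext_d br A + (1 / 2) *\<^sub>R wedge_by lb A A"

definition g2_instanton :: "('v::real_vector \<Rightarrow> 'v \<Rightarrow> 'v) \<Rightarrow> ('g::real_vector \<Rightarrow> 'g \<Rightarrow> 'g) \<Rightarrow>
    ('v, real) form \<Rightarrow> ('v, 'g) form \<Rightarrow> bool" where
  "g2_instanton br lb \<phi> A \<longleftrightarrow> wedge_by (\<lambda>y r. r *\<^sub>R y) (curvature br lb A) (g2_psi \<phi>) = 0"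

definition heterotic_bianchi :: "('v::real_vector \<Rightarrow> 'v \<Rightarrow> 'v) \<Rightarrow> ('g::real_vector \<Rightarrow> 'g \<Rightarrow> 'g) \<Rightarrow>
    ('g \<Rightarrow> 'g \<Rightarrow> real) \<Rightarrow> ('v, real) form \<Rightarrow> ('v, 'g) form \<Rightarrow> bool" where
  "heterotic_bianchi br lb K \<phi> A \<longleftrightarrow>
     ext_d br (g2_torsion br \<phi>) = wedge_by K (curvature br lb A) (curvature br lb A)"

definition heterotic_g2_system :: "('v::real_vector \<Rightarrow> 'v \<Rightarrow> 'v) \<Rightarrow> ('g::real_vector \<Rightarrow> 'g \<Rightarrow> 'g) \<Rightarrow>
    ('g \<Rightarrow> 'g \<Rightarrow> real) \<Rightarrow> ('v, real) form \<Rightarrow> ('v, 'g) form \<Rightarrow> bool" where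
  "heterotic_g2_system br lb K \<phi> A \<longleftrightarrow> g2_structure \<phi> \<and> invariant_pairing lb K \<and>
     ext_d br (g2_psi \<phi>) = (4 *\<^sub>R tau1 br \<phi>) \<^bold>\<and> g2_psi \<phi> \<and>
     g2_instanton br lb \<phi> A \<and> heterotic_bianchi br lb K \<phi> A"


section \<open>The family of \<open>G\<^sub>2\<close>-structures and the connection\<close>

definition dual_basis :: "nat \<Rightarrow> (nat \<Rightarrow> ('v::real_vector, real) form) \<Rightarrow> bool" where
  "dual_basis n e \<longleftrightarrow> inj_on e {1..n} \<and> independent (e ` {1..n}) \<and> span (e ` {1..n}) = forms 1"

definition sigma1_plus :: "(nat \<Rightarrow> ('v, real) form) \<Rightarrow> ('v, real) form" where
  "sigma1_plus e = e 1 \<^bold>\<and> e 3 - e 2 \<^bold>\<and> e 4"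

definition sigma2_plus :: "(nat \<Rightarrow> ('v, real) form) \<Rightarrow> ('v, real) form" where
  "sigma2_plus e = - (e 1 \<^bold>\<and> e 4) - e 2 \<^bold>\<and> e 3"

definition sigma3_plus :: "(nat \<Rightarrow> ('v, real) form) \<Rightarrow> ('v, real) form" where
  "sigma3_plus e = e 1 \<^bold>\<and> e 2 + e 3 \<^bold>\<and> e 4"

definition sigma1_minus :: "(nat \<Rightarrow> ('v, real) form) \<Rightarrow> ('v, real) form" where
  "sigma1_minus e = e 1 \<^bold>\<and> e 3 + e 2 \<^bold>\<and> e 4"

definition sigma2_minus :: "(nat \<Rightarrow> ('v, real) form) \<Rightarrow> ('v, real) form" where
  "sigma2_minus e = e 1 \<^bold>\<and> e 4 - e 2 \<^bold>\<and> e 3"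

definition sigma3_minus :: "(nat \<Rightarrow> ('v, real) form) \<Rightarrow> ('v, real) form" where
  "sigma3_minus e = e 1 \<^bold>\<and> e 2 - e 3 \<^bold>\<and> e 4"

text \<open>\<open>rotated_coframe e B i\<close> for \<open>i = 1, 2, 3\<close> is \<open>E\<^sup>5, E\<^sup>6, E\<^sup>7\<close>.\<close>

definition rotated_coframe ::
    "(nat \<Rightarrow> ('v, real) form) \<Rightarrow> real ^ 3 ^ 3 \<Rightarrow> 3 \<Rightarrow> ('v, real) form" where
  "rotated_coframe e B i = B $ i $ 1 *\<^sub>R e 5 + B $ i $ 2 *\<^sub>R e 6 + B $ i $ 3 *\<^sub>R e 7"

definition phi_family :: "(nat \<Rightarrow> ('v, real) form) \<Rightarrow> real ^ 3 ^ 3 \<Rightarrow> ('v, real) form" where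
  "phi_family e B = (let E5 = rotated_coframe e B 1; E6 = rotated_coframe e B 2;
       E7 = rotated_coframe e B 3
     in sigma1_plus e \<^bold>\<and> E5 + sigma2_plus e \<^bold>\<and> E6 + sigma3_plus e \<^bold>\<and> E7 + E5 \<^bold>\<and> E6 \<^bold>\<and> E7)"

definition connection_form ::
    "(nat \<Rightarrow> ('v, real) form) \<Rightarrow> 'g \<Rightarrow> 'g \<Rightarrow> 'g::real_vector \<Rightarrow> ('v, 'g) form" where
  "connection_form e Y5 Y6 Y7 = (\<lambda>xs. e 5 xs *\<^sub>R Y5 + e 6 xs *\<^sub>R Y6 + e 7 xs *\<^sub>R Y7)"

end

theory Submission
  imports Defs
begin

text \<open>
  The rotation is absorbed into the coframe \<open>E = (e\<^sup>1, \<dots>, e\<^sup>4, E\<^sup>5, E\<^sup>6, E\<^sup>7)\<close>, in which \<open>\<phi>\<close> has constant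
  coefficients, \<open>E\<close> is orthonormal, and \<open>dE\<^sup>5, dE\<^sup>6, dE\<^sup>7\<close> are combinations of the anti-self-dual forms
  \<open>\<sigma>\<^sub>j\<^sup>-\<close>. As \<open>\<sigma>\<^sub>i\<^sup>+ \<and> \<sigma>\<^sub>j\<^sup>- = 0\<close>, only \<open>E\<^sup>5 \<and> E\<^sup>6 \<and> E\<^sup>7\<close> contributes to \<open>d\<phi>\<close>; hence \<open>d\<psi> = 0\<close>,
  \<open>\<tau>\<^sub>0 = 0\<close>, \<open>\<tau>\<^sub>1 = 0\<close> and \<open>T = - \<star>d\<phi> = \<Sum> dE\<^sup>i \<and> E\<^sup>i\<close>. Orthogonality of the rotation gives
  \<open>dT = \<Sum> dE\<^sup>i \<and> dE\<^sup>i = - 2 (\<epsilon>\<^sub>1\<^sup>2 + \<epsilon>\<^sub>2\<^sup>2 + \<epsilon>\<^sub>3\<^sup>2) e\<^sup>1\<^sup>2\<^sup>3\<^sup>4\<close>.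

  The forms \<open>de\<^sup>i\<close> are annihilated by \<open>\<psi>\<close>, so \<open>F \<and> \<psi>\<close> only sees the brackets \<open>\<lambda>\<^sub>5 e\<^sup>6\<^sup>7 Y\<^sub>5 + \<dots>\<close>, and it
  vanishes only if all \<open>\<lambda>\<^sub>i\<close> do. In that case \<open>\<langle>F \<and> F\<rangle> = - 2 (\<Sum> \<langle>Y\<^sub>i, Y\<^sub>i\<rangle> \<epsilon>\<^sub>i\<^sup>2) e\<^sup>1\<^sup>2\<^sup>3\<^sup>4\<close>, so any pairing
  with \<open>\<langle>Y\<^sub>i, Y\<^sub>i\<rangle> = 1\<close> solves the Bianchi identity, and the off-diagonal entries remain free to adjust
  the signature.
\<close>

section \<open>Exterior algebra\<close>

lemma Pow_lessThan_Suc_split: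
  "(\<Sum>I\<in>Pow {..<Suc n}. h I) =
     (\<Sum>I\<in>Pow {..<n}. h (insert 0 (Suc ` I))) + (\<Sum>I\<in>Pow {..<n}. h (Suc ` I))"
  for h :: "nat set \<Rightarrow> 'a::comm_monoid_add"
proof -
  have Pow_eq: "Pow {..<Suc n} = (\<lambda>I. insert 0 (Suc ` I)) ` Pow {..<n} \<union> (`) Suc ` Pow {..<n}"
    unfolding lessThan_Suc_eq_insert_0 Pow_insert image_Pow_surj[OF refl, symmetric]
    by (simp add: image_image Un_commute)
  have "inj_on (\<lambda>I. insert 0 (Suc ` I)) (Pow {..<n})"
    by (rule inj_on_inverseI[where g = "\<lambda>J. Suc -` J"]) auto
  moreover have "inj_on ((`) Suc) (Pow {..<n})"
    by (meson inj_Suc inj_on_image inj_on_subset subset_UNIV)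
  moreover have "(\<lambda>I. insert 0 (Suc ` I)) ` Pow {..<n} \<inter> (`) Suc ` Pow {..<n} = {}"
    by auto
  ultimately show ?thesis
    unfolding Pow_eq by (subst sum.union_disjoint) (simp_all add: sum.reindex)
qed

text \<open>Position \<open>0\<close> is chosen and has nothing below it, so no inversion involves
  it; the others are shifted by one.\<close>

lemma shuffle_sign_insert_0:
  "shuffle_sign (insert 0 (Suc ` I)) (Suc n) = shuffle_sign I n"
proof -
  have "{(i, j). i \<in> insert 0 (Suc ` I) \<and> j \<in> {..<Suc n} - insert 0 (Suc ` I) \<and> j < i} =
      map_prod Suc Suc ` {(i, j). i \<in> I \<and> j \<in> {..<n} - I \<and> j < i}" (is "_ = _ ` ?S")
    by (force simp: image_iff lessThan_Suc_eq_insert_0)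
  moreover have "inj_on (map_prod Suc Suc) ?S"
    by (auto intro!: inj_onI)
  ultimately show ?thesis
    by (simp add: shuffle_sign_def card_image)
qed

text \<open>Here \<open>0\<close> falls in the complement and lies below every chosen position,
  adding \<open>card I\<close> inversions.\<close>

lemma shuffle_sign_Suc:
  assumes "I \<subseteq> {..<n}"
  shows "shuffle_sign (Suc ` I) (Suc n) = (- 1) ^ card I * shuffle_sign I n"
proof -
  have fin: "finite I"
    using assms finite_subset by blast
  have eq: "{(i, j). i \<in> Suc ` I \<and> j \<in> {..<Suc n} - Suc ` I \<and> j < i} =
      (\<lambda>i. (Suc i, 0)) ` I \<union> map_prod Suc Suc ` {(i, j). i \<in> I \<and> j \<in> {..<n} - I \<and> j < i}"
    (is "_ = _ \<union> _ ` ?S")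
    by (force simp: image_iff lessThan_Suc_eq_insert_0)
  have "?S \<subseteq> I \<times> {..<n}"
    by auto
  then have "finite ?S"
    using fin finite_subset by blast
  then have card: "card ((\<lambda>i. (Suc i, 0::nat)) ` I \<union> map_prod Suc Suc ` ?S) = card I + card ?S"
    using fin by (subst card_Un_disjoint) (auto simp: card_image inj_on_def)
  show ?thesis
    unfolding shuffle_sign_def eq card power_add ..
qed

section \<open>Grade involution and recursion of the wedge product\<close>

definition grade_inv :: "('v, real) form \<Rightarrow> ('v, real) form" where
  "grade_inv \<omega> = (\<lambda>xs. (- 1) ^ length xs * \<omega> xs)"

definition unit_form :: "('v, real) form" where
  "unit_form = (\<lambda>xs. if xs = [] then 1 else 0)"

lemma form_eqI:
  assumes "\<omega> [] = \<eta> []" "\<And>x. interior x \<omega> = interior x \<eta>"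
  shows "\<omega> = \<eta>"
proof
  fix xs
  show "\<omega> xs = \<eta> xs"
    using assms by (cases xs) (auto simp: interior_def fun_eq_iff)
qed

lemma wedge_Nil [simp]: "(\<alpha> \<^bold>\<and> \<beta>) [] = \<alpha> [] * \<beta> []"
  by (simp add: wedge_by_def shuffle_sign_def)

text \<open>The shuffles are sorted by which factor receives \<open>x\<close>. Handing it to
  \<open>\<beta>\<close> moves it past all arguments of \<open>\<alpha>\<close>; recording that sign
  by \<open>grade_inv\<close> instead of a degree keeps the rule valid for inhomogeneous
  functions.\<close>

lemma wedge_Cons:
  "(\<alpha> \<^bold>\<and> \<beta>) (x # xs) = (interior x \<alpha> \<^bold>\<and> \<beta>) xs + (grade_inv \<alpha> \<^bold>\<and> interior x \<beta>) xs"
proof -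
  let ?n = "length xs"
  have "(\<alpha> \<^bold>\<and> \<beta>) (x # xs) = 
     (\<Sum>I\<in>Pow {..<?n}. shuffle_sign I ?n * (\<alpha> (x # nths xs I) * \<beta> (nths xs (- I)))) +
     (\<Sum>I\<in>Pow {..<?n}. shuffle_sign (Suc ` I) (Suc ?n) *
        (\<alpha> (nths xs I) * \<beta> (x # nths xs (- I))))"
    unfolding wedge_by_def list.size add_0_right add_Suc_right Pow_lessThan_Suc_split
    by (simp add: nths_Cons shuffle_sign_insert_0 Compl_eq inj_image_mem_iff)
  moreover have "card I = length (nths xs I)" if "I \<in> Pow {..<?n}" for I
    using that by (auto simp: length_nths intro!: arg_cong[where f = card])
  ultimately show ?thesis
    by (simp add: wedge_by_def grade_inv_def interior_def shuffle_sign_Suc mult_ac)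
qed

text \<open>Together with the value on the empty list this recursion determines the wedge product, and it
  holds for arbitrary functions on lists, alternating or not; so identities such as associativity
  follow by induction on the list of arguments.\<close>

lemma interior_wedge:
  "interior x (\<alpha> \<^bold>\<and> \<beta>) = interior x \<alpha> \<^bold>\<and> \<beta> + grade_inv \<alpha> \<^bold>\<and> interior x \<beta>"
  by (simp add: interior_def wedge_Cons fun_eq_iff)

lemma interior_add [simp]: "interior x (\<alpha> + \<beta>) = interior x \<alpha> + interior x \<beta>"
  and interior_diff [simp]: "interior x (\<alpha> - \<beta>) = interior x \<alpha> - interior x \<beta>"
  and interior_minus [simp]: "interior x (- \<alpha>) = - interior x \<alpha>"
  and interior_zero [simp]: "interior x 0 = 0"
  and interior_scaleR [simp]: "interior x (c *\<^sub>R \<alpha>) = c *\<^sub>R interior x \<alpha>"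
  for \<alpha> \<beta> :: "('v, 'b::real_vector) form"
  by (simp_all add: interior_def fun_eq_iff)

lemma wedge_add_left [simp]: "(\<alpha> + \<alpha>') \<^bold>\<and> \<beta> = \<alpha> \<^bold>\<and> \<beta> + \<alpha>' \<^bold>\<and> \<beta>"
  and wedge_add_right [simp]: "\<alpha> \<^bold>\<and> (\<beta> + \<beta>') = \<alpha> \<^bold>\<and> \<beta> + \<alpha> \<^bold>\<and> \<beta>'"
  and wedge_diff_left [simp]: "(\<alpha> - \<alpha>') \<^bold>\<and> \<beta> = \<alpha> \<^bold>\<and> \<beta> - \<alpha>' \<^bold>\<and> \<beta>"
  and wedge_diff_right [simp]: "\<alpha> \<^bold>\<and> (\<beta> - \<beta>') = \<alpha> \<^bold>\<and> \<beta> - \<alpha> \<^bold>\<and> \<beta>'"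
  and wedge_minus_left [simp]: "(- \<alpha>) \<^bold>\<and> \<beta> = - (\<alpha> \<^bold>\<and> \<beta>)"
  and wedge_minus_right [simp]: "\<alpha> \<^bold>\<and> (- \<beta>) = - (\<alpha> \<^bold>\<and> \<beta>)"
  and wedge_zero_left [simp]: "0 \<^bold>\<and> \<beta> = 0"
  and wedge_zero_right [simp]: "\<alpha> \<^bold>\<and> 0 = 0"
  and wedge_scaleR_left [simp]: "(c *\<^sub>R \<alpha>) \<^bold>\<and> \<beta> = c *\<^sub>R (\<alpha> \<^bold>\<and> \<beta>)"
  and wedge_scaleR_right [simp]: "\<alpha> \<^bold>\<and> (c *\<^sub>R \<beta>) = c *\<^sub>R (\<alpha> \<^bold>\<and> \<beta>)"
  by (simp_all add: wedge_by_def fun_eq_iff algebra_simps sum.distrib sum_subtractf sum_negf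
      sum_distrib_left)

lemma wedge_sum_left: "(\<Sum>i\<in>A. \<omega> i) \<^bold>\<and> \<beta> = (\<Sum>i\<in>A. \<omega> i \<^bold>\<and> \<beta>)"
  and wedge_sum_right: "\<beta> \<^bold>\<and> (\<Sum>i\<in>A. \<omega> i) = (\<Sum>i\<in>A. \<beta> \<^bold>\<and> \<omega> i)"
  by (rule sum_comp_morphism[of "\<lambda>\<alpha>. \<alpha> \<^bold>\<and> \<beta>" \<omega>, unfolded comp_def, symmetric]
      sum_comp_morphism[of "\<lambda>\<alpha>. \<beta> \<^bold>\<and> \<alpha>" \<omega>, unfolded comp_def, symmetric];
      (rule wedge_zero_left wedge_zero_right wedge_add_left wedge_add_right)+)+

lemma grade_inv_add [simp]: "grade_inv (\<alpha> + \<beta>) = grade_inv \<alpha> + grade_inv \<beta>"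
  and grade_inv_diff [simp]: "grade_inv (\<alpha> - \<beta>) = grade_inv \<alpha> - grade_inv \<beta>"
  and grade_inv_minus [simp]: "grade_inv (- \<alpha>) = - grade_inv \<alpha>"
  and grade_inv_zero [simp]: "grade_inv 0 = 0"
  and grade_inv_scaleR [simp]: "grade_inv (c *\<^sub>R \<alpha>) = c *\<^sub>R grade_inv \<alpha>"
  and grade_inv_Nil [simp]: "grade_inv \<alpha> [] = \<alpha> []"
  and grade_inv_grade_inv [simp]: "grade_inv (grade_inv \<alpha>) = \<alpha>"
  and interior_grade_inv [simp]: "interior x (grade_inv \<alpha>) = - grade_inv (interior x \<alpha>)"
  by (simp_all add: grade_inv_def interior_def fun_eq_iff algebra_simps flip: power_add mult_2)

lemma grade_inv_wedge [simp]: "grade_inv (\<alpha> \<^bold>\<and> \<beta>) = grade_inv \<alpha> \<^bold>\<and> grade_inv \<beta>"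
proof
  fix xs
  show "grade_inv (\<alpha> \<^bold>\<and> \<beta>) xs = (grade_inv \<alpha> \<^bold>\<and> grade_inv \<beta>) xs"
  proof (induction xs arbitrary: \<alpha> \<beta>)
    case (Cons x xs)
    have "grade_inv (\<alpha> \<^bold>\<and> \<beta>) (x # xs) =
        - grade_inv (interior x \<alpha> \<^bold>\<and> \<beta>) xs - grade_inv (grade_inv \<alpha> \<^bold>\<and> interior x \<beta>) xs"
      by (simp add: grade_inv_def[of "_ \<^bold>\<and> _"] wedge_Cons algebra_simps)
    then show ?case
      unfolding Cons.IH by (simp add: wedge_Cons)
  qed simp
qed

lemma wedge_assoc [simp]: "(\<alpha> \<^bold>\<and> \<beta>) \<^bold>\<and> \<gamma> = \<alpha> \<^bold>\<and> \<beta> \<^bold>\<and> \<gamma>"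
proof
  fix xs
  show "((\<alpha> \<^bold>\<and> \<beta>) \<^bold>\<and> \<gamma>) xs = (\<alpha> \<^bold>\<and> \<beta> \<^bold>\<and> \<gamma>) xs"
    by (induction xs arbitrary: \<alpha> \<beta> \<gamma>) (simp_all add: wedge_Cons interior_wedge)
qed

lemma interior_unit_form [simp]: "interior x unit_form = 0"
  and grade_inv_unit_form [simp]: "grade_inv unit_form = unit_form"
  and unit_form_Nil [simp]: "unit_form [] = 1"
  by (simp_all add: unit_form_def interior_def grade_inv_def fun_eq_iff)

lemma wedge_unit_left [simp]: "unit_form \<^bold>\<and> \<alpha> = \<alpha>"
proof
  show "(unit_form \<^bold>\<and> \<alpha>) xs = \<alpha> xs" for xs
    by (induction xs arbitrary: \<alpha>) (simp_all add: wedge_Cons, simp add: interior_def)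
qed

lemma wedge_unit_right [simp]: "\<alpha> \<^bold>\<and> unit_form = \<alpha>"
proof
  show "(\<alpha> \<^bold>\<and> unit_form) xs = \<alpha> xs" for xs
    by (induction xs arbitrary: \<alpha>) (simp_all add: wedge_Cons, simp add: interior_def)
qed


subsection \<open>Forms as alternating multilinear functions\<close>

definition homogeneous :: "nat \<Rightarrow> ('v, real) form \<Rightarrow> bool" where
  "homogeneous k \<omega> \<longleftrightarrow> (\<forall>xs. length xs \<noteq> k \<longrightarrow> \<omega> xs = 0)"

text \<open>Stated for adjacent transpositions, so that it passes to contractions at once;
  \<open>forms_iff\<close> relates it to vanishing on repeated arguments.\<close>

definition alternating :: "('v, real) form \<Rightarrow> bool" where
  "alternating \<omega> \<longleftrightarrow> (\<forall>us x y vs. \<omega> (us @ x # y # vs) = - \<omega> (us @ y # x # vs))"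

definition multilinear :: "('v::real_vector, real) form \<Rightarrow> bool" where
  "multilinear \<omega> \<longleftrightarrow> (\<forall>us vs. linear (\<lambda>x. \<omega> (us @ x # vs)))"

lemma homogeneous_interior: "homogeneous (Suc k) \<omega> \<Longrightarrow> homogeneous k (interior x \<omega>)"
  by (simp add: homogeneous_def interior_def)

lemma homogeneous_wedge:
  assumes "homogeneous p \<alpha>" "homogeneous q \<beta>"
  shows "homogeneous (p + q) (\<alpha> \<^bold>\<and> \<beta>)"
  unfolding homogeneous_def
proof (intro allI impI)
  fix xs :: "'a list"
  assume len: "length xs \<noteq> p + q"
  have "\<alpha> (nths xs I) = 0 \<or> \<beta> (nths xs (- I)) = 0" for I
  proof -
    \<comment> \<open>The factors receive complementary argument lists, so for a wrong total length
      one of them sees a wrong degree.\<close>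
    have "length (nths xs I) + length (nths xs (- I)) = length xs"
      unfolding length_nths
      by (subst card_Un_disjoint[symmetric]) (auto simp: Collect_disj_eq[symmetric] intro!: arg_cong[where f = card, of _ "{..<length xs}", simplified])
    then show ?thesis
      using assms len unfolding homogeneous_def by metis
  qed
  then show "(\<alpha> \<^bold>\<and> \<beta>) xs = 0"
    by (auto simp: wedge_by_def intro!: sum.neutral)
qed

lemma alternating_interior: "alternating \<omega> \<Longrightarrow> alternating (interior x \<omega>)"
  unfolding alternating_def interior_def by (metis append_Cons)

lemma alternating_interior_swap:
  "alternating \<omega> \<Longrightarrow> interior x (interior y \<omega>) = - interior y (interior x \<omega>)"
  unfolding alternating_def interior_def by (auto simp: fun_eq_iff) (metis append_Nil)

lemma alternating_grade_inv: "alternating \<omega> \<Longrightarrow> alternating (grade_inv \<omega>)"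
  unfolding alternating_def grade_inv_def by (metis length_append length_Cons mult_minus_right)

lemma alternating_add: "alternating \<alpha> \<Longrightarrow> alternating \<beta> \<Longrightarrow> alternating (\<alpha> + \<beta>)"
  and alternating_minus: "alternating \<alpha> \<Longrightarrow> alternating (- \<alpha>)"
  and alternating_scaleR: "alternating \<alpha> \<Longrightarrow> alternating (c *\<^sub>R \<alpha>)"
  unfolding alternating_def plus_fun_apply fun_Compl_def scaleR_fun_apply
  by (metis minus_add_distrib, metis, metis scaleR_minus_right)

lemma alternating_wedge:
  assumes "alternating \<alpha>" "alternating \<beta>"
  shows "alternating (\<alpha> \<^bold>\<and> \<beta>)"
  unfolding alternating_def
proof (intro allI)
  fix us x y vs
  show "(\<alpha> \<^bold>\<and> \<beta>) (us @ x # y # vs) = - (\<alpha> \<^bold>\<and> \<beta>) (us @ y # x # vs)"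
    using assms
  proof (induction us arbitrary: \<alpha> \<beta>)
    case Nil
    \<comment> \<open>Both leading arguments are contracted. Double contractions of one factor
      change sign, and the two mixed terms are exchanged with opposite sign because contraction
      anticommutes with \<open>grade_inv\<close>.\<close>
    have "interior y (interior x \<alpha>) = - interior x (interior y \<alpha>)"
      "interior y (interior x \<beta>) = - interior x (interior y \<beta>)"
      by (simp_all only: alternating_interior_swap[of _ y x] Nil)
    then show ?case
      by (simp add: wedge_Cons interior_wedge)
  next
    case (Cons u us)
    then show ?case
      by (simp add: wedge_Cons alternating_interior alternating_grade_inv)
  qed
qed


lemma multilinear_interior: "multilinear \<omega> \<Longrightarrow> multilinear (interior x \<omega>)"
  unfolding multilinear_def interior_def append_Cons[symmetric] by blast

lemma multilinear_linear:
  assumes "multilinear \<omega>"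
  shows "linear (\<lambda>x. \<omega> (x # xs))"
proof -
  have "linear (\<lambda>x. \<omega> ([] @ x # xs))"
    using assms unfolding multilinear_def by blast
  then show ?thesis
    by simp
qed

lemma multilinear_add: "multilinear \<alpha> \<Longrightarrow> multilinear \<beta> \<Longrightarrow> multilinear (\<alpha> + \<beta>)"
  and multilinear_minus: "multilinear \<alpha> \<Longrightarrow> multilinear (- \<alpha>)"
  and multilinear_scaleR: "multilinear \<alpha> \<Longrightarrow> multilinear (c *\<^sub>R \<alpha>)"
  unfolding multilinear_def plus_fun_apply fun_Compl_def scaleR_fun_apply
  by (simp_all add: linear_compose_add linear_compose_neg linear_compose_scale_right
      del: real_scaleR_def)

lemma multilinear_grade_inv: "multilinear \<omega> \<Longrightarrow> multilinear (grade_inv \<omega>)"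
  unfolding multilinear_def grade_inv_def length_append list.size real_scaleR_def[symmetric]
  by (simp only: linear_compose_scale_right simp_thms)

lemma multilinear_wedge:
  assumes "multilinear \<alpha>" "multilinear \<beta>"
  shows "multilinear (\<alpha> \<^bold>\<and> \<beta>)"
  unfolding multilinear_def
proof (intro allI)
  fix us vs
  show "linear (\<lambda>x. (\<alpha> \<^bold>\<and> \<beta>) (us @ x # vs))"
    using assms
  proof (induction us arbitrary: \<alpha> \<beta>)
    case Nil
    have "linear (\<lambda>x. c * (\<alpha> (x # xs) * \<beta> ys))" for c xs ys
      using linear_compose_scale_right[OF multilinear_linear[OF Nil(1)], of "c * \<beta> ys"]
      by (simp add: mult_ac)
    moreover have "linear (\<lambda>x. c * (grade_inv \<alpha> xs * \<beta> (x # ys)))" for c xs ys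
      using linear_compose_scale_right[OF multilinear_linear[OF Nil(2)], of "c * grade_inv \<alpha> xs"]
      by (simp add: mult_ac)
    ultimately show ?case
      unfolding append_Nil wedge_Cons
      unfolding wedge_by_def interior_def real_scaleR_def
      by (intro linear_compose_add linear_compose_sum ballI) auto
  next
    case (Cons u us)
    then show ?case
      unfolding append_Cons wedge_Cons
      by (intro linear_compose_add Cons.IH multilinear_interior multilinear_grade_inv) auto
  qed
qed

section \<open>Permuting the arguments of alternating functions\<close>

lemma alternating_move:
  assumes "alternating \<omega>"
  shows "\<omega> (us @ x # vs) = (- 1) ^ length us * \<omega> (x # us @ vs)"
  using assms
proof (induction us arbitrary: \<omega>)
  case (Cons u us)
  have "\<omega> ((u # us) @ x # vs) = (- 1) ^ length us * interior u \<omega> (x # us @ vs)"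
    using Cons.IH[OF alternating_interior[OF Cons.prems], of u] by (simp add: interior_def)
  moreover have "\<omega> ([] @ u # x # us @ vs) = - \<omega> ([] @ x # u # us @ vs)"
    using Cons.prems unfolding alternating_def by blast
  ultimately show ?case
    by (simp add: interior_def)
qed simp

lemma alternating_abs_move: "alternating \<omega> \<Longrightarrow> \<bar>\<omega> (us @ x # vs)\<bar> = \<bar>\<omega> (x # us @ vs)\<bar>"
  by (simp add: alternating_move abs_mult power_abs)

text \<open>The head of \<open>xs\<close> is located in \<open>ys\<close> and moved to the front,
  then the tails are compared after contracting with it. Absolute values spare the bookkeeping of
  permutation signs.\<close>

lemma alternating_abs_mset:
  assumes "alternating \<omega>" "mset xs = mset ys"
  shows "\<bar>\<omega> xs\<bar> = \<bar>\<omega> ys\<bar>"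
  using assms
proof (induction xs arbitrary: ys \<omega>)
  case (Cons x xs)
  then obtain us vs where ys: "ys = us @ x # vs"
    by (metis in_set_conv_decomp list.set_intros(1) mset_eq_setD)
  then have "\<bar>interior x \<omega> xs\<bar> = \<bar>interior x \<omega> (us @ vs)\<bar>"
    using Cons.prems by (intro Cons.IH alternating_interior) auto
  then show ?case
    using alternating_abs_move[OF Cons.prems(1), of us x vs] ys by (simp add: interior_def)
qed simp

text \<open>Up to sign, two equal entries can be brought to the front, where exchanging them shows
  the value to be its own negative.\<close>

lemma alternating_not_distinct:
  assumes "alternating \<omega>" "\<not> distinct xs"
  shows "\<omega> xs = 0"
proof -
  obtain us vs ws x where xs: "xs = us @ [x] @ vs @ [x] @ ws"
    using not_distinct_decomp[OF assms(2)] by blast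
  have "\<bar>\<omega> xs\<bar> = \<bar>\<omega> (x # x # us @ vs @ ws)\<bar>"
    by (rule alternating_abs_mset[OF assms(1)]) (simp add: xs)
  moreover have "\<omega> (x # x # us @ vs @ ws) = 0"
  proof -
    have "\<omega> ([] @ x # x # us @ vs @ ws) = - \<omega> ([] @ x # x # us @ vs @ ws)"
      using assms(1) unfolding alternating_def by blast
    then show ?thesis
      unfolding append_Nil by linarith
  qed
  ultimately show ?thesis
    by linarith
qed

lemma forms_iff: "\<omega> \<in> forms k \<longleftrightarrow> homogeneous k \<omega> \<and> multilinear \<omega> \<and> alternating \<omega>"
proof (intro iffI conjI)
  assume \<omega>: "\<omega> \<in> forms k"
  then show hom: "homogeneous k \<omega>"
    by (auto simp: forms_def homogeneous_def)
  show lin: "multilinear \<omega>"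
    unfolding multilinear_def
  proof (intro allI)
    fix us vs
    show "linear (\<lambda>x. \<omega> (us @ x # vs))"
    proof (cases "length us + length vs + 1 = k")
      case True
      then show ?thesis
        using \<omega> by (simp add: forms_def)
    next
      case False
      \<comment> \<open>In a wrong degree the function is constantly zero, hence still
        linear.\<close>
      then have "(\<lambda>x. \<omega> (us @ x # vs)) = (\<lambda>x. 0)"
        using hom by (auto simp: homogeneous_def)
      then show ?thesis
        by (simp add: linear_zero)
    qed
  qed
  show "alternating \<omega>"
    unfolding alternating_def
  proof (intro allI)
    fix us x y vs
    have zero: "\<omega> (us @ z # z # vs) = 0" for z
      using \<omega> by (cases "length (us @ z # z # vs) = k") (auto simp: forms_def)
    have add1: "\<omega> (us @ (a + b) # zs) = \<omega> (us @ a # zs) + \<omega> (us @ b # zs)" for a b zs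
    proof -
      have "linear (\<lambda>x. \<omega> (us @ x # zs))"
        using lin unfolding multilinear_def by blast
      from linear_add[OF this] show ?thesis .
    qed
    have add2: "\<omega> (us @ z # (a + b) # vs) = \<omega> (us @ z # a # vs) + \<omega> (us @ z # b # vs)" for a b z
    proof -
      have "linear (\<lambda>x. \<omega> ((us @ [z]) @ x # vs))"
        using lin unfolding multilinear_def by blast
      from linear_add[OF this] show ?thesis
        by simp
    qed
    \<comment> \<open>Polarisation: the value at the repeated argument \<open>x + y\<close> is zero
      and expands into the two mixed terms.\<close>
    show "\<omega> (us @ x # y # vs) = - \<omega> (us @ y # x # vs)"
      using zero[of "x + y"] zero[of x] zero[of y] unfolding add1 add2 by simp
  qed
next
  assume "homogeneous k \<omega> \<and> multilinear \<omega> \<and> alternating \<omega>"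
  then show "\<omega> \<in> forms k"
    unfolding forms_def by (simp add: homogeneous_def multilinear_def alternating_not_distinct)
qed

lemma forms_add: "\<alpha> \<in> forms k \<Longrightarrow> \<beta> \<in> forms k \<Longrightarrow> \<alpha> + \<beta> \<in> forms k"
  and forms_minus: "\<alpha> \<in> forms k \<Longrightarrow> - \<alpha> \<in> forms k"
  and forms_scaleR: "\<alpha> \<in> forms k \<Longrightarrow> c *\<^sub>R \<alpha> \<in> forms k"
  unfolding forms_iff
  by (auto intro: multilinear_add multilinear_minus multilinear_scaleR
      alternating_add alternating_minus alternating_scaleR) (simp_all add: homogeneous_def)

lemma forms_diff: "\<alpha> \<in> forms k \<Longrightarrow> \<beta> \<in> forms k \<Longrightarrow> \<alpha> - \<beta> \<in> forms k"
  using forms_add[of \<alpha> k "- \<beta>"] forms_minus[of \<beta>] by simp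

lemma forms_wedge: "\<alpha> \<in> forms p \<Longrightarrow> \<beta> \<in> forms q \<Longrightarrow> \<alpha> \<^bold>\<and> \<beta> \<in> forms (p + q)"
  unfolding forms_iff using homogeneous_wedge multilinear_wedge alternating_wedge by blast

section \<open>Calculus of one-forms\<close>

lemma one_form_Nil: "\<eta> \<in> forms 1 \<Longrightarrow> \<eta> [] = 0"
  by (simp add: forms_def)

lemma interior_one_form: "\<eta> \<in> forms 1 \<Longrightarrow> interior x \<eta> = \<eta> [x] *\<^sub>R unit_form"
  by (auto simp: forms_def interior_def unit_form_def fun_eq_iff)

lemma grade_inv_one_form: "\<eta> \<in> forms 1 \<Longrightarrow> grade_inv \<eta> = - \<eta>"
proof
  fix xs
  assume "\<eta> \<in> forms 1"
  then show "grade_inv \<eta> xs = (- \<eta>) xs"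
    by (cases "length xs = 1") (simp_all add: forms_def grade_inv_def)
qed

lemma one_form_wedge_swap:
  assumes "\<eta> \<in> forms 1" "\<zeta> \<in> forms 1"
  shows "\<eta> \<^bold>\<and> \<zeta> = - (\<zeta> \<^bold>\<and> \<eta>)"
proof (rule form_eqI)
  fix x
  show "interior x (\<eta> \<^bold>\<and> \<zeta>) = interior x (- (\<zeta> \<^bold>\<and> \<eta>))"
    unfolding interior_minus interior_wedge assms[THEN interior_one_form]
      assms[THEN grade_inv_one_form] by simp
qed (simp add: assms[THEN one_form_Nil])

lemma one_form_wedge_left_swap:
  assumes "\<eta> \<in> forms 1" "\<zeta> \<in> forms 1"
  shows "\<eta> \<^bold>\<and> \<zeta> \<^bold>\<and> \<omega> = - (\<zeta> \<^bold>\<and> \<eta> \<^bold>\<and> \<omega>)"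
  using arg_cong[OF one_form_wedge_swap[OF assms], of "\<lambda>\<beta>. \<beta> \<^bold>\<and> \<omega>"] by simp

lemma real_vector_eq_neg: "x = - x \<Longrightarrow> x = 0" for x :: "'a::real_vector"
  by (metis eq_neg_iff_add_eq_0 scaleR_2 scaleR_eq_0_iff zero_neq_numeral)

lemma one_form_wedge_self: "\<eta> \<in> forms 1 \<Longrightarrow> \<eta> \<^bold>\<and> \<eta> = 0"
  by (metis one_form_wedge_swap real_vector_eq_neg)

lemma one_form_wedge_left_self: "\<eta> \<in> forms 1 \<Longrightarrow> \<eta> \<^bold>\<and> \<eta> \<^bold>\<and> \<omega> = 0"
  using arg_cong[OF one_form_wedge_self, of \<eta> "\<lambda>\<beta>. \<beta> \<^bold>\<and> \<omega>"] by simp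

text \<open>Contracting with a vector of \<open>F\<close> lowers the degree, so induction kills
  these contractions; linearity in the first slot extends this to every vector.\<close>

lemma forms_vanish:
  assumes "\<omega> \<in> forms k" "span F = UNIV" "\<And>fs. length fs = k \<Longrightarrow> set fs \<subseteq> F \<Longrightarrow> \<omega> fs = 0"
  shows "\<omega> = 0"
  using assms
proof (induction k arbitrary: \<omega>)
  case 0
  have "\<omega> xs = 0" for xs
  proof (cases "xs = []")
    case True
    then show ?thesis
      using 0(3)[of "[]"] by simp
  next
    case False
    then show ?thesis
      using 0(1) unfolding forms_iff homogeneous_def by blast
  qed
  then show ?case
    by (simp add: fun_eq_iff)
next
  case (Suc k)
  have "interior f \<omega> = 0" if "f \<in> F" for f
  proof (rule Suc.IH)
    show "interior f \<omega> \<in> forms k"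
      using Suc.prems(1) unfolding forms_iff
      by (metis homogeneous_interior multilinear_interior alternating_interior)
    show "interior f \<omega> fs = 0" if "length fs = k" "set fs \<subseteq> F" for fs
      using Suc.prems(3)[of "f # fs"] that \<open>f \<in> F\<close> unfolding interior_def by simp
  qed (rule Suc.prems(2))
  then have zero: "\<omega> (f # xs) = 0" if "f \<in> F" for f xs
    using that by (simp add: interior_def fun_eq_iff)
  show ?case
  proof (rule form_eqI)
    show "\<omega> [] = 0 []"
      using Suc.prems(1) by (simp add: forms_def)
    fix x
    have "\<omega> (x # xs) = 0" for xs
    proof (rule linear_eq_0_on_span[of "\<lambda>x. \<omega> (x # xs)" F])
      show "linear (\<lambda>x. \<omega> (x # xs))"
        using Suc.prems(1) unfolding forms_iff by (metis multilinear_linear)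
      show "x \<in> span F"
        using assms(2) by simp
    qed (rule zero)
    then show "interior x \<omega> = interior x 0"
      by (simp add: interior_def fun_eq_iff)
  qed
qed

lemma multilinear_map_scaleR:
  "multilinear \<omega> \<Longrightarrow> \<omega> (map ((*\<^sub>R) r) xs) = r ^ length xs * \<omega> xs"
proof (induction xs arbitrary: \<omega>)
  case (Cons x xs)
  have "\<omega> (map ((*\<^sub>R) r) (x # xs)) = r * interior x \<omega> (map ((*\<^sub>R) r) xs)"
    using linear_scale[OF multilinear_linear[OF Cons.prems], of r x "map ((*\<^sub>R) r) xs"]
    by (simp only: interior_def list.map real_scaleR_def)
  also have "\<dots> = r * (r ^ length xs * interior x \<omega> xs)"
    by (simp only: Cons.IH[OF multilinear_interior[OF Cons.prems]])
  finally show ?case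
    by (simp add: interior_def)
qed simp


section \<open>Contraction with orthonormal frames and the Hodge star\<close>

text \<open>Pairing a linear relation with one of its vectors isolates that coefficient. Nonzero
  squares take the place of definiteness, so that indefinite pairings are covered too.\<close>

lemma orthogonal_independent:
  fixes K :: "'v::real_vector \<Rightarrow> 'v \<Rightarrow> real"
  assumes K: "bilinear K" and nz: "\<And>x. x \<in> S \<Longrightarrow> K x x \<noteq> 0"
    and orth: "\<And>x y. x \<in> S \<Longrightarrow> y \<in> S \<Longrightarrow> x \<noteq> y \<Longrightarrow> K x y = 0"
  shows "independent S"
proof
  assume "dependent S"
  then obtain t u x where t: "finite t" "t \<subseteq> S" "(\<Sum>v\<in>t. u v *\<^sub>R v) = 0" and x: "x \<in> t" "u x \<noteq> 0"
    unfolding dependent_explicit by blast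
  have lin: "linear (\<lambda>v. K v x)"
    using K by (simp add: bilinear_def)
  have "0 = K (\<Sum>v\<in>t. u v *\<^sub>R v) x"
    using t linear_0[OF lin] by simp
  also have "\<dots> = (\<Sum>v\<in>t. u v * K v x)"
    by (simp add: linear_sum[OF lin] linear_scale[OF lin])
  also have "\<dots> = (\<Sum>v\<in>t. if v = x then u x * K x x else 0)"
    using t x orth by (intro sum.cong) auto
  also have "\<dots> = u x * K x x"
    using t x by simp
  finally show False
    using x t nz by auto
qed

lemma orthonormal_basis_card:
  assumes "inner_product g" "orthonormal_basis g (F :: 'v::real_vector set)"
  shows "card F = dim (UNIV :: 'v set)"
proof -
  have "independent F"
    using assms unfolding inner_product_def orthonormal_basis_def
    by (intro orthogonal_independent[of g]) auto
  then show ?thesis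
    using assms(2) unfolding orthonormal_basis_def by (metis dim_span dim_eq_card_independent)
qed

lemma orthonormal_expansion:
  assumes g: "inner_product g" and F: "orthonormal_basis g F" "finite F"
  shows "x = (\<Sum>f\<in>F. g f x *\<^sub>R f)"
proof (rule linear_eq_on[of "\<lambda>x. x" "\<lambda>x. \<Sum>f\<in>F. g f x *\<^sub>R f" x F])
  show "linear (\<lambda>x. x)"
    by (rule linear_ident)
  have "linear (g f)" for f
    using g by (simp add: inner_product_def bilinear_def)
  then show "linear (\<lambda>x. \<Sum>f\<in>F. g f x *\<^sub>R f)"
    by (intro linear_compose_sum ballI)
      (simp add: linear_iff scaleR_add_left)
  show "x \<in> span F"
    using F by (simp add: orthonormal_basis_def)
  show "b = (\<Sum>f\<in>F. g f b *\<^sub>R f)" if "b \<in> F" for b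
  proof -
    have "(\<Sum>f\<in>F. g f b *\<^sub>R f) = (\<Sum>f\<in>F. if f = b then b else 0)"
      using F that by (intro sum.cong) (auto simp: orthonormal_basis_def)
    then show ?thesis
      using F that by simp
  qed
qed

text \<open>This is invariance of the \<open>g\<close>-trace: one slot is expanded in
  \<open>F'\<close>, the sums are exchanged, and the other slot is reassembled from
  \<open>F\<close>.\<close>

lemma orthonormal_trace_eq:
  fixes b :: "'v::real_vector \<Rightarrow> 'v \<Rightarrow> real"
  assumes g: "inner_product g" and b: "bilinear b"
    and F: "orthonormal_basis g F" "finite F" and F': "orthonormal_basis g F'" "finite F'"
  shows "(\<Sum>f\<in>F. b f f) = (\<Sum>f\<in>F'. b f f)"
proof -
  have lin: "linear (b x)" "linear (\<lambda>x. b x y)" "linear (g x)" "linear (\<lambda>x. g x y)" for x y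
    using b g by (auto simp: bilinear_def inner_product_def)
  have expand: "b x y = (\<Sum>h\<in>F'. g h x * b h y)" for x y
    using arg_cong[OF orthonormal_expansion[OF g F', of x], of "\<lambda>x. b x y"]
    by (simp add: linear_sum[OF lin(2)] linear_scale[OF lin(2)])
  have "(\<Sum>f\<in>F. b f f) = (\<Sum>f\<in>F. \<Sum>h\<in>F'. g h f * b h f)"
    by (subst expand) simp
  also have "\<dots> = (\<Sum>h\<in>F'. \<Sum>f\<in>F. g h f * b h f)"
    by (rule sum.swap)
  also have "\<dots> = (\<Sum>h\<in>F'. b h (\<Sum>f\<in>F. g f h *\<^sub>R f))"
    using g by (simp add: linear_sum[OF lin(1)] linear_scale[OF lin(1)] inner_product_def)
  also have "\<dots> = (\<Sum>h\<in>F'. b h h)"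
    by (simp only: orthonormal_expansion[OF g F, symmetric])
  finally show ?thesis .
qed

lemma sum_lists_Suc:
  fixes h :: "'v list \<Rightarrow> 'a::comm_monoid_add"
  assumes "finite F"
  shows "(\<Sum>fs | length fs = Suc k \<and> set fs \<subseteq> F. h fs) =
    (\<Sum>f\<in>F. \<Sum>fs | length fs = k \<and> set fs \<subseteq> F. h (f # fs))"
proof -
  have "{fs. length fs = Suc k \<and> set fs \<subseteq> F} =
      (\<lambda>(f, fs). f # fs) ` (F \<times> {fs. length fs = k \<and> set fs \<subseteq> F})"
    by (auto simp: length_Suc_conv image_iff)
  moreover have "inj_on (\<lambda>(f, fs). f # fs) (F \<times> {fs. length fs = k \<and> set fs \<subseteq> F})"
    by (auto simp: inj_on_def)
  ultimately show ?thesis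
    by (simp add: sum.reindex sum.cartesian_product case_prod_unfold)
qed

text \<open>The full contraction is an iterated trace: the induction hypothesis changes the frame in
  all slots but the first, and \<open>orthonormal_trace_eq\<close> changes it there.\<close>

lemma contraction_frame_eq:
  assumes g: "inner_product g"
    and F: "orthonormal_basis g F" "finite F" and F': "orthonormal_basis g F'" "finite F'"
    and "multilinear \<beta>" "multilinear \<gamma>"
  shows "(\<Sum>fs | length fs = k \<and> set fs \<subseteq> F. \<beta> fs * \<gamma> fs) =
    (\<Sum>fs | length fs = k \<and> set fs \<subseteq> F'. \<beta> fs * \<gamma> fs)"
  using assms(6,7)
proof (induction k arbitrary: \<beta> \<gamma>)
  case 0
  have "{fs. length fs = 0 \<and> set fs \<subseteq> A} = {[]}" for A :: "'a set"
    by auto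
  then show ?case
    by simp
next
  case (Suc k)
  let ?L' = "{fs. length fs = k \<and> set fs \<subseteq> F'}"
  have "linear (\<lambda>y. \<beta> (x # gs) * \<gamma> (y # gs))" "linear (\<lambda>x. \<beta> (x # gs) * \<gamma> (y # gs))" for x y gs
    using linear_compose_scale_right[OF multilinear_linear[OF Suc.prems(2)], of "\<beta> (x # gs)" gs]
      linear_compose_scale_right[OF multilinear_linear[OF Suc.prems(1)], of "\<gamma> (y # gs)" gs]
    by (simp_all add: mult.commute)
  then have bil: "bilinear (\<lambda>x y. \<Sum>gs\<in>?L'. \<beta> (x # gs) * \<gamma> (y # gs))"
    unfolding bilinear_def by (auto intro!: linear_compose_sum)
  have "(\<Sum>fs | length fs = Suc k \<and> set fs \<subseteq> F. \<beta> fs * \<gamma> fs) =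
      (\<Sum>f\<in>F. \<Sum>fs | length fs = k \<and> set fs \<subseteq> F. interior f \<beta> fs * interior f \<gamma> fs)"
    by (simp add: sum_lists_Suc F interior_def)
  also have "\<dots> = (\<Sum>f\<in>F. \<Sum>fs\<in>?L'. interior f \<beta> fs * interior f \<gamma> fs)"
    by (intro sum.cong Suc.IH multilinear_interior Suc.prems refl)
  also have "\<dots> = (\<Sum>f\<in>F'. \<Sum>fs\<in>?L'. interior f \<beta> fs * interior f \<gamma> fs)"
    using orthonormal_trace_eq[OF g bil F F'] by (simp only: interior_def)
  finally show ?case
    by (simp add: sum_lists_Suc F' interior_def)
qed

text \<open>Frees the star from the arbitrary choice of basis in its definition, so that it can be
  computed in a given frame.\<close>

lemma hodge_star_frame:
  assumes g: "inner_product g" and F: "orthonormal_basis g F" "finite F"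
    and \<beta>: "multilinear \<beta>" and vol: "multilinear vol"
  shows "hodge_star g vol \<beta> xs = (let k = dim (UNIV :: 'v::real_vector set) - length xs
    in (1 / fact k) * (\<Sum>fs | length fs = k \<and> set fs \<subseteq> F. \<beta> fs * vol (fs @ (xs :: 'v list))))"
proof -
  define F' where "F' = (SOME F. orthonormal_basis g F)"
  have F': "orthonormal_basis g F'"
    unfolding F'_def using F(1) by (rule someI)
  have fin: "finite F'"
  \<comment> \<open>An infinite set has \<open>card\<close> 0, so a positive common cardinality
    forces finiteness; an empty \<open>F\<close> leaves only the zero space.\<close>
  proof (cases "F = {}")
    case True
    have "span F = UNIV"
      using F(1) unfolding orthonormal_basis_def by blast
    then have "(UNIV :: 'v set) = {0}"
      unfolding True span_empty by (rule sym)
    then show ?thesis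
      by (metis finite_subset finite.simps subset_UNIV)
  next
    case False
    then have "card F \<noteq> 0"
      using F(2) by simp
    then have "card F' \<noteq> 0"
      unfolding orthonormal_basis_card[OF g F(1)] orthonormal_basis_card[OF g F'] .
    then show ?thesis
      by (intro card_ge_0_finite) (rule neq0_conv[THEN iffD1])
  qed
  have ml: "multilinear (\<lambda>fs. vol (fs @ xs))"
    using vol unfolding multilinear_def append_assoc append_Cons by blast
  show ?thesis
    unfolding hodge_star_def Let_def F'_def[symmetric]
    by (simp only: contraction_frame_eq[OF g F F' fin \<beta> ml])
qed

lemma hodge_star_add: "hodge_star g vol (\<alpha> + \<beta>) = hodge_star g vol \<alpha> + hodge_star g vol \<beta>"
  and hodge_star_diff: "hodge_star g vol (\<alpha> - \<beta>) = hodge_star g vol \<alpha> - hodge_star g vol \<beta>"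
  and hodge_star_minus: "hodge_star g vol (- \<alpha>) = - hodge_star g vol \<alpha>"
  and hodge_star_zero: "hodge_star g vol 0 = 0"
  and hodge_star_scaleR: "hodge_star g vol (c *\<^sub>R \<alpha>) = c *\<^sub>R hodge_star g vol \<alpha>"
  by (simp_all add: hodge_star_def Let_def fun_eq_iff sum.distrib sum_subtractf sum_negf
      algebra_simps sum_distrib_left)

text \<open>When \<open>F\<close> is an orthonormal basis, the hypothesis on \<open>v\<close> says that it is the metric dual of \<open>\<eta>\<close>.\<close>

lemma contraction_wedge:
  assumes F: "finite F" and \<eta>: "\<eta> \<in> forms 1"
    and v: "\<And>h :: 'v::real_vector \<Rightarrow> real. linear h \<Longrightarrow> (\<Sum>f\<in>F. \<eta> [f] * h f) = h v"
    and "multilinear \<gamma>" "alternating \<gamma>"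
  shows "(\<Sum>fs | length fs = Suc k \<and> set fs \<subseteq> F. (\<eta> \<^bold>\<and> \<beta>) fs * \<gamma> fs) =
    (1 + real k) * (\<Sum>fs | length fs = k \<and> set fs \<subseteq> F. \<beta> fs * \<gamma> (v # fs))"
  using assms(4,5)
proof (induction k arbitrary: \<beta> \<gamma>)
  case 0
  have "{fs. length fs = 0 \<and> set fs \<subseteq> F} = {[]}"
    by auto
  moreover have "(\<Sum>f\<in>F. (\<eta> [f] * \<beta> []) * \<gamma> [f]) = \<beta> [] * \<gamma> [v]"
    using v[OF multilinear_linear[OF 0(1), of "[]"]] by (simp add: mult_ac flip: sum_distrib_left)
  ultimately show ?case
    by (simp add: sum_lists_Suc F wedge_Cons interior_one_form[OF \<eta>] one_form_Nil[OF \<eta>])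
next
  case (Suc k)
  define L where "L = (\<lambda>k. {fs. length fs = k \<and> set fs \<subseteq> F})"
  have lin: "linear (\<lambda>f. \<Sum>gs\<in>L (Suc k). \<beta> gs * \<gamma> (f # gs))"
    using linear_compose_scale_right[OF multilinear_linear[OF Suc.prems(1)]]
    by (auto intro!: linear_compose_sum)
  have swap: "\<gamma> (f # v # gs) = - \<gamma> (v # f # gs)" for f gs
    using alternating_interior_swap[OF Suc.prems(2), of v f] by (simp add: interior_def fun_eq_iff)
  have "(\<Sum>fs\<in>L (Suc (Suc k)). (\<eta> \<^bold>\<and> \<beta>) fs * \<gamma> fs) =
     (\<Sum>f\<in>F. \<eta> [f] * (\<Sum>gs\<in>L (Suc k). \<beta> gs * \<gamma> (f # gs))) -
     (\<Sum>f\<in>F. \<Sum>gs\<in>L (Suc k). (\<eta> \<^bold>\<and> interior f \<beta>) gs * interior f \<gamma> gs)"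
    unfolding L_def
    by (subst sum_lists_Suc[OF F]) (simp add: wedge_Cons interior_one_form[OF \<eta>]
        grade_inv_one_form[OF \<eta>] interior_def[of _ \<gamma>] algebra_simps sum.distrib sum_subtractf
        sum_distrib_left)
  \<comment> \<open>The induction hypothesis yields \<open>1 + k\<close> copies of the target sum,
    with a sign that interchanging \<open>f\<close> and \<open>v\<close> removes; the first sum
    above is one further copy.\<close>
  also have "(\<Sum>f\<in>F. \<Sum>gs\<in>L (Suc k). (\<eta> \<^bold>\<and> interior f \<beta>) gs * interior f \<gamma> gs) =
      (\<Sum>f\<in>F. (1 + real k) * (\<Sum>gs\<in>L k. interior f \<beta> gs * interior f \<gamma> (v # gs)))"
    unfolding L_def
    by (intro sum.cong refl Suc.IH multilinear_interior alternating_interior Suc.prems)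
  also have "\<dots> = (1 + real k) * - (\<Sum>f\<in>F. \<Sum>gs\<in>L k. \<beta> (f # gs) * \<gamma> (v # f # gs))"
    by (simp only: interior_def swap mult_minus_right sum_negf sum_distrib_left)
  also have "(\<Sum>f\<in>F. \<Sum>gs\<in>L k. \<beta> (f # gs) * \<gamma> (v # f # gs)) =
      (\<Sum>gs\<in>L (Suc k). \<beta> gs * \<gamma> (v # gs))"
    by (simp only: L_def sum_lists_Suc[OF F])
  finally have "(\<Sum>fs\<in>L (Suc (Suc k)). (\<eta> \<^bold>\<and> \<beta>) fs * \<gamma> fs) =
      (1 + real (Suc k)) * (\<Sum>gs\<in>L (Suc k). \<beta> gs * \<gamma> (v # gs))"
    unfolding v[OF lin] by (simp only: of_nat_Suc distrib_right mult_minus_right)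
  then show ?case
    by (simp only: L_def)
qed

text \<open>A determinant-free argument: the sum of the squares of \<open>\<omega>\<close> over all
  lists of frame vectors is the same for every orthonormal frame, and only permutations of the frame
  contribute to it, each with the same square.\<close>

lemma alternating_abs_orthonormal:
  fixes \<omega> :: "('v::real_vector, real) form"
  assumes g: "inner_product g" and fs: "distinct fs" "orthonormal_basis g (set fs)"
    and gs: "distinct gs" "orthonormal_basis g (set gs)"
    and \<omega>: "multilinear \<omega>" "alternating \<omega>"
  shows "\<bar>\<omega> fs\<bar> = \<bar>\<omega> gs\<bar>"
proof -
  define n where "n = dim (UNIV :: 'v set)"
  \<comment> \<open>This is n!, in the shape produced by
    \<open>card_lists_distinct_length_eq\<close>.\<close>
  define c where "c = real (\<Prod>{n - n + 1..n})"
  have sq: "(\<Sum>hs | length hs = n \<and> set hs \<subseteq> set xs. \<omega> hs * \<omega> hs) = c * (\<omega> xs)\<^sup>2"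
    if xs: "distinct xs" "orthonormal_basis g (set xs)" for xs
  proof -
    have card: "card (set xs) = n"
      unfolding n_def by (rule orthonormal_basis_card[OF g xs(2)])
    have "(\<Sum>hs | length hs = n \<and> set hs \<subseteq> set xs. \<omega> hs * \<omega> hs) =
        (\<Sum>hs | length hs = n \<and> distinct hs \<and> set hs \<subseteq> set xs. \<omega> hs * \<omega> hs)"
    proof (intro sum.mono_neutral_right)
      have "{hs. length hs = n \<and> set hs \<subseteq> set xs} = {hs. set hs \<subseteq> set xs \<and> length hs = n}"
        by blast
      then show "finite {hs. length hs = n \<and> set hs \<subseteq> set xs}"
        using finite_lists_length_eq[of "set xs" n] by simp
    qed (use alternating_not_distinct[OF \<omega>(2)] in auto)
    also have "\<dots> = (\<Sum>hs | length hs = n \<and> distinct hs \<and> set hs \<subseteq> set xs. (\<omega> xs)\<^sup>2)"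
    proof (rule sum.cong[OF refl])
      fix hs
      assume "hs \<in> {hs. length hs = n \<and> distinct hs \<and> set hs \<subseteq> set xs}"
      then have hs: "distinct hs" "length hs = n" "set hs \<subseteq> set xs"
        by blast+
      then have "card (set hs) = card (set xs)"
        using card distinct_card by metis
      then have "set hs = set xs"
        using hs(3) card_subset_eq finite_set by metis
      then have "mset hs = mset xs"
        using set_eq_iff_mset_eq_distinct[OF hs(1) xs(1)] by blast
      then have "\<bar>\<omega> hs\<bar> = \<bar>\<omega> xs\<bar>"
        by (rule alternating_abs_mset[OF \<omega>(2)])
      then show "\<omega> hs * \<omega> hs = (\<omega> xs)\<^sup>2"
        using power2_abs[of "\<omega> hs"] power2_abs[of "\<omega> xs"] unfolding power2_eq_square by metis
    qed
    also have "\<dots> = c * (\<omega> xs)\<^sup>2"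
    proof -
      have "card {hs. length hs = n \<and> distinct hs \<and> set hs \<subseteq> set xs} = \<Prod>{n - n + 1..n}"
        using card_lists_distinct_length_eq[OF finite_set, of n xs] unfolding card by blast
      then show ?thesis
        by (simp only: sum_constant c_def)
    qed
    finally show ?thesis .
  qed
  have "c * (\<omega> fs)\<^sup>2 = c * (\<omega> gs)\<^sup>2"
    unfolding sq[OF fs, symmetric] sq[OF gs, symmetric]
    by (rule contraction_frame_eq[OF g fs(2) _ gs(2) _ \<omega>(1) \<omega>(1)]) simp_all
  moreover have "c \<noteq> 0"
    by (simp add: c_def prod_zero_iff del: of_nat_prod)
  ultimately have "(\<omega> fs)\<^sup>2 = (\<omega> gs)\<^sup>2"
    using mult_left_cancel[of c "(\<omega> fs)\<^sup>2" "(\<omega> gs)\<^sup>2"] by blast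
  then show ?thesis
    unfolding real_sqrt_abs[symmetric] by (rule arg_cong)
qed


section \<open>The model \<open>G\<^sub>2\<close>-structure of a coframe\<close>

text \<open>Extending \<open>S\<close> to a basis adds no vectors, since the cardinalities agree.
  The condition \<open>card S \<noteq> 0\<close> excludes infinite dimension, where
  \<open>dim\<close> is 0.\<close>

lemma span_eq_UNIV_of_card:
  fixes S :: "'v::real_vector set"
  assumes S: "independent S" and card: "card S = dim (UNIV :: 'v set)" "card S \<noteq> 0"
  shows "span S = UNIV"
proof -
  obtain G where G: "S \<subseteq> G" "independent G" "UNIV \<subseteq> span G"
    by (rule maximal_independent_subset_extend[OF subset_UNIV S])
  then have span: "span G = UNIV"
    by blast
  then have "card G = card S"
    using dim_span[of G] dim_eq_card_independent[OF G(2)] card by simp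
  moreover have "finite G"
    using calculation card by (intro card_ge_0_finite) simp
  ultimately have "S = G"
    using card_subset_eq[OF _ G(1)] by simp
  then show ?thesis
    using span by simp
qed

text \<open>Carrying the dual frame along turns every contraction with a basis vector into a rewrite
  step. The locale is used for \<open>e\<close> as well as for the rotated coframe.\<close>

locale coframe =
  fixes E :: "nat \<Rightarrow> ('v::real_vector, real) form" and f :: "nat \<Rightarrow> 'v"
  assumes dim7: "dim (UNIV :: 'v set) = 7"
    and one_form: "i \<in> {1..7} \<Longrightarrow> E i \<in> forms 1"
    and dual: "i \<in> {1..7} \<Longrightarrow> j \<in> {1..7} \<Longrightarrow> E i [f j] = (if i = j then 1 else 0)"
begin

declare One_nat_def [simp del]

lemma linear_coord: "i \<in> {1..7} \<Longrightarrow> linear (\<lambda>x. E i [x])"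
  using one_form multilinear_linear unfolding forms_iff by blast

lemma inj_frame: "inj_on f {1..7}"
  by (rule inj_onI) (metis dual zero_neq_one)

lemma coord_sum: "i \<in> {1..7} \<Longrightarrow> E i [\<Sum>j\<in>{1..7}. c j *\<^sub>R f j] = c i"
proof -
  assume i: "i \<in> {1..7}"
  have "E i [\<Sum>j\<in>{1..7}. c j *\<^sub>R f j] = (\<Sum>j\<in>{1..7}. c j * E i [f j])"
    by (simp add: linear_sum[OF linear_coord[OF i]] linear_scale[OF linear_coord[OF i]])
  also have "\<dots> = (\<Sum>j\<in>{1..7}. if i = j then c j else 0)"
    using dual[OF i] by (intro sum.cong) auto
  finally show ?thesis
    using i by simp
qed

lemma independent_frame: "independent (f ` {1..7})"
proof
  assume "dependent (f ` {1..7})"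
  then obtain u j where u: "(\<Sum>v\<in>f ` {1..7}. u v *\<^sub>R v) = 0" and j: "j \<in> {1..7}" "u (f j) \<noteq> 0"
    by (auto simp: dependent_finite)
  have "(\<Sum>j\<in>{1..7}. u (f j) *\<^sub>R f j) = 0"
    using u unfolding sum.reindex[OF inj_frame] comp_def .
  then have "u (f j) = 0"
    using coord_sum[OF j(1), of "\<lambda>j. u (f j)"] linear_0[OF linear_coord[OF j(1)]] by simp
  then show False
    using j by simp
qed

lemma span_frame: "span (f ` {1..7}) = UNIV"
proof -
  have "card (f ` {1..7}) = 7"
    by (simp add: card_image[OF inj_frame])
  then show ?thesis
    by (intro span_eq_UNIV_of_card independent_frame) (simp_all add: dim7)
qed

lemma expansion: "x = (\<Sum>i\<in>{1..7}. E i [x] *\<^sub>R f i)"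
proof -
  have fin: "finite (f ` {1..7})"
    by (intro finite_imageI finite_atLeastAtMost)
  have "x \<in> range (\<lambda>u. \<Sum>v\<in>f ` {1..7}. u v *\<^sub>R v)"
    unfolding span_finite[OF fin, symmetric] span_frame by (rule UNIV_I)
  then obtain u where "x = (\<Sum>v\<in>f ` {1..7}. u v *\<^sub>R v)"
    by (rule rangeE)
  then have x: "x = (\<Sum>j\<in>{1..7}. u (f j) *\<^sub>R f j)"
    unfolding sum.reindex[OF inj_frame] comp_def .
  have "E i [x] = u (f i)" if "i \<in> {1..7}" for i
    unfolding x by (rule coord_sum[OF that])
  then have "(\<Sum>i\<in>{1..7}. E i [x] *\<^sub>R f i) = (\<Sum>j\<in>{1..7}. u (f j) *\<^sub>R f j)"
    by (intro sum.cong) auto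
  then show ?thesis
    using x by (rule trans[OF _ sym, rotated])
qed

section \<open>Metric, volume form and three-form of a coframe\<close>

definition metric :: "'v \<Rightarrow> 'v \<Rightarrow> real" where
  "metric x y = (\<Sum>i\<in>{1..7}. E i [x] * E i [y])"

definition vol :: "('v, real) form" where
  "vol = E 1 \<^bold>\<and> E 2 \<^bold>\<and> E 3 \<^bold>\<and> E 4 \<^bold>\<and> E 5 \<^bold>\<and> E 6 \<^bold>\<and> E 7"

text \<open>This is \<open>phi_family\<close> expanded into monomials with increasing indices, the
  rotation being hidden in \<open>E\<close>.\<close>

definition phi :: "('v, real) form" where
  "phi = E 1 \<^bold>\<and> E 3 \<^bold>\<and> E 5 - E 2 \<^bold>\<and> E 4 \<^bold>\<and> E 5 - E 1 \<^bold>\<and> E 4 \<^bold>\<and> E 6 - E 2 \<^bold>\<and> E 3 \<^bold>\<and> E 6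
     + E 1 \<^bold>\<and> E 2 \<^bold>\<and> E 7 + E 3 \<^bold>\<and> E 4 \<^bold>\<and> E 7 + E 5 \<^bold>\<and> E 6 \<^bold>\<and> E 7"

text \<open>Oriented towards strictly increasing indices: in this normal form, identities between
  forms with constant coefficients reduce to comparing monomials.\<close>

lemma wedge_sort:
  "j < i \<Longrightarrow> i \<in> {1..7} \<Longrightarrow> j \<in> {1..7} \<Longrightarrow> E i \<^bold>\<and> E j = - (E j \<^bold>\<and> E i)"
  "j < i \<Longrightarrow> i \<in> {1..7} \<Longrightarrow> j \<in> {1..7} \<Longrightarrow> E i \<^bold>\<and> E j \<^bold>\<and> \<omega> = - (E j \<^bold>\<and> E i \<^bold>\<and> \<omega>)"
  "i \<in> {1..7} \<Longrightarrow> E i \<^bold>\<and> E i = 0"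
  "i \<in> {1..7} \<Longrightarrow> E i \<^bold>\<and> E i \<^bold>\<and> \<omega> = 0"
  by (rule one_form_wedge_swap one_form_wedge_left_swap one_form_wedge_self
      one_form_wedge_left_self; rule one_form; assumption)+

lemma interior_frame:
  "i \<in> {1..7} \<Longrightarrow> j \<in> {1..7} \<Longrightarrow> interior (f i) (E j) = (if i = j then unit_form else 0)"
  "i \<in> {1..7} \<Longrightarrow> j \<in> {1..7} \<Longrightarrow>
     interior (f i) (E j \<^bold>\<and> \<omega>) = (if i = j then \<omega> else 0) - E j \<^bold>\<and> interior (f i) \<omega>"
  by (auto simp: interior_wedge interior_one_form[OF one_form] grade_inv_one_form[OF one_form] dual)

lemma inner_product_metric: "inner_product metric"
  unfolding inner_product_def bilinear_def
proof (intro conjI allI impI)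
  have sym: "metric x y = metric y x" for x y
    by (simp add: metric_def mult.commute)
  have "linear (\<lambda>x. a * E i [x])" if "i \<in> {1..7}" for a i
    using linear_compose_scale_right[OF linear_coord[OF that], of a] by (simp only: real_scaleR_def)
  then show lin: "linear (metric x)" for x
    unfolding metric_def[abs_def] by (intro linear_compose_sum ballI)
  show "linear (\<lambda>x. metric x y)" for y
    unfolding sym[of _ y] by (rule lin)
  show "metric x y = metric y x" for x y
    by (rule sym)
next
  fix x :: 'v
  assume "x \<noteq> 0"
  have "\<exists>i\<in>{1..7}. E i [x] \<noteq> 0"
  proof (rule ccontr)
    assume "\<not> ?thesis"
    then have "(\<Sum>i\<in>{1..7}. E i [x] *\<^sub>R f i) = 0"
      by (intro sum.neutral) auto
    with expansion[of x] have "x = 0"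
      by (rule trans)
    with \<open>x \<noteq> 0\<close> show False
      by (rule notE)
  qed
  then obtain i where i: "i \<in> {1..7}" "E i [x] \<noteq> 0"
    by blast
  then have "0 < E i [x] * E i [x]"
    by (simp add: zero_less_mult_iff linorder_neq_iff disj_commute)
  then show "0 < metric x x"
    unfolding metric_def using i by (intro sum_pos2[of _ i]) auto
qed

lemma metric_frame: "i \<in> {1..7} \<Longrightarrow> j \<in> {1..7} \<Longrightarrow> metric (f i) (f j) = (if i = j then 1 else 0)"
proof -
  assume "i \<in> {1..7}" "j \<in> {1..7}"
  then have "metric (f i) (f j) = (\<Sum>k\<in>{1..7}. if k = i then (if i = j then 1 else 0) else 0)"
    unfolding metric_def by (intro sum.cong) (auto simp: dual)
  then show ?thesis
    using \<open>i \<in> {1..7}\<close> by simp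
qed

lemma orthonormal_frame: "orthonormal_basis metric (f ` {1..7})"
  unfolding orthonormal_basis_def
  using span_frame metric_frame inj_on_eq_iff[OF inj_frame] by auto

lemma vol_in_forms: "vol \<in> forms 7"
proof -
  have "vol \<in> forms (1 + (1 + (1 + (1 + (1 + (1 + 1))))))"
    unfolding vol_def by (intro forms_wedge one_form) auto
  then show ?thesis
    by simp
qed

lemma phi_in_forms: "phi \<in> forms 3"
proof -
  have "phi \<in> forms (1 + (1 + 1))"
    unfolding phi_def by (intro forms_add forms_diff forms_wedge one_form) auto
  then show ?thesis
    by (simp add: numeral_3_eq_3)
qed

lemma frame_list: "set (map f [1..<8]) = f ` {1..7}" "distinct (map f [1..<8])"
proof -
  have "{1..<8} = {1..7::nat}"
    by auto
  then show "set (map f [1..<8]) = f ` {1..7}" "distinct (map f [1..<8])"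
    using inj_frame by (simp_all add: distinct_map)
qed

lemma vol_frame: "vol (map f [1..<8]) = 1"
proof -
  have "vol (map f [1..<8]) = interior (f 7) (interior (f 6) (interior (f 5) (interior (f 4)
      (interior (f 3) (interior (f 2) (interior (f 1) vol)))))) []"
    by (simp add: interior_def upt_rec)
  also have "\<dots> = 1"
    unfolding vol_def by (simp add: interior_frame)
  finally show ?thesis .
qed

text \<open>The value on \<open>f\<close> is 1, and by \<open>alternating_abs_orthonormal\<close> a
  single orthonormal basis suffices.\<close>

lemma volume_form_vol: "volume_form metric vol"
  unfolding volume_form_def
proof (intro conjI allI impI)
  show "vol \<in> forms (dim (UNIV :: 'v set))"
    by (simp add: dim7 vol_in_forms)
  fix fs
  assume "distinct fs \<and> orthonormal_basis metric (set fs)"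
  then have "\<bar>vol fs\<bar> = \<bar>vol (map f [1..<8])\<bar>"
    using vol_in_forms unfolding forms_iff
    by (intro alternating_abs_orthonormal[OF inner_product_metric])
      (auto simp: frame_list orthonormal_frame simp del: set_map)
  then show "\<bar>vol fs\<bar> = 1"
    by (simp add: vol_frame)
qed

text \<open>The difference of the two sides vanishes on the ordered frame, hence on its
  permutations, and on lists with repetitions by alternation; these are all lists of seven frame
  vectors.\<close>

lemma top_form_eq:
  assumes "\<omega> \<in> forms 7"
  shows "\<omega> = \<omega> (map f [1..<8]) *\<^sub>R vol"
proof -
  let ?c = "\<omega> (map f [1..<8])"
  let ?\<eta> = "\<omega> - ?c *\<^sub>R vol"
  have \<eta>: "?\<eta> \<in> forms 7"
    by (intro forms_diff forms_scaleR assms vol_in_forms)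
  have "?\<eta> = 0"
  proof (rule forms_vanish[OF \<eta> span_frame])
    fix fs
    assume fs: "length fs = 7" "set fs \<subseteq> f ` {1..7}"
    have alt: "alternating ?\<eta>"
      using \<eta> forms_iff by blast
    show "?\<eta> fs = 0"
    proof (cases "distinct fs")
      case True
      then have "set fs = f ` {1..7}"
        using fs by (intro card_subset_eq) (simp_all add: distinct_card card_image[OF inj_frame])
      then have "\<bar>?\<eta> fs\<bar> = \<bar>?\<eta> (map f [1..<8])\<bar>"
        using True frame_list
        by (intro alternating_abs_mset[OF alt] iffD1[OF set_eq_iff_mset_eq_distinct]) auto
      then show ?thesis
        by (simp add: vol_frame)
    qed (rule alternating_not_distinct[OF alt])
  qed
  then show ?thesis
    by simp
qed

end


section \<open>Metric and orientation determined by \<open>phi\<close>\<close>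

context coframe
begin

lemma interior_phi:
  "interior (f 1) phi = E 3 \<^bold>\<and> E 5 - E 4 \<^bold>\<and> E 6 + E 2 \<^bold>\<and> E 7"
  "interior (f 2) phi = - (E 4 \<^bold>\<and> E 5) - E 3 \<^bold>\<and> E 6 - E 1 \<^bold>\<and> E 7"
  "interior (f 3) phi = - (E 1 \<^bold>\<and> E 5) + E 2 \<^bold>\<and> E 6 + E 4 \<^bold>\<and> E 7"
  "interior (f 4) phi = E 2 \<^bold>\<and> E 5 + E 1 \<^bold>\<and> E 6 - E 3 \<^bold>\<and> E 7"
  "interior (f 5) phi = E 1 \<^bold>\<and> E 3 - E 2 \<^bold>\<and> E 4 + E 6 \<^bold>\<and> E 7"
  "interior (f 6) phi = - (E 1 \<^bold>\<and> E 4) - E 2 \<^bold>\<and> E 3 - E 5 \<^bold>\<and> E 7"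
  "interior (f 7) phi = E 1 \<^bold>\<and> E 2 + E 3 \<^bold>\<and> E 4 + E 5 \<^bold>\<and> E 6"
  unfolding phi_def by (simp_all add: interior_frame)

lemma index_cases: "i \<in> {1..7::nat} \<longleftrightarrow> i = 1 \<or> i = 2 \<or> i = 3 \<or> i = 4 \<or> i = 5 \<or> i = 6 \<or> i = 7"
  by auto

text \<open>Forty-nine explicit computations with sorted monomials, from which bilinearity gives the
  defining identity of the metric.\<close>

lemma phi_metric_frame:
  assumes "i \<in> {1..7}" "j \<in> {1..7}"
  shows "interior (f i) phi \<^bold>\<and> interior (f j) phi \<^bold>\<and> phi = (if i = j then 6 else 0) *\<^sub>R vol"
  using assms unfolding index_cases
  by (elim disjE; hypsubst; simp add: interior_phi)
    (simp_all add: phi_def vol_def wedge_sort fun_eq_iff)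

lemma interior_expansion:
  assumes "multilinear \<omega>"
  shows "interior x \<omega> = (\<Sum>i\<in>{1..7}. E i [x] *\<^sub>R interior (f i) \<omega>)"
proof
  fix xs
  note lin = multilinear_linear[OF assms, of xs]
  have "\<omega> (x # xs) = \<omega> ((\<Sum>i\<in>{1..7}. E i [x] *\<^sub>R f i) # xs)"
    by (rule arg_cong[OF expansion])
  also have "\<dots> = (\<Sum>i\<in>{1..7}. E i [x] * \<omega> (f i # xs))"
    by (simp add: linear_sum[OF lin] linear_scale[OF lin])
  also have "\<dots> = (\<Sum>i\<in>{1..7}. E i [x] *\<^sub>R interior (f i) \<omega>) xs"
    by (subst sum_comp_morphism[of "\<lambda>\<eta>. \<eta> xs", symmetric]) (simp_all add: interior_def)
  finally show "interior x \<omega> xs = (\<Sum>i\<in>{1..7}. E i [x] *\<^sub>R interior (f i) \<omega>) xs"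
    by (simp only: interior_def)
qed

lemma induces_metric_phi: "induces_metric phi metric vol"
  unfolding induces_metric_def
proof (intro conjI allI inner_product_metric volume_form_vol)
  fix x y
  have ml: "multilinear phi"
    using phi_in_forms forms_iff by blast
  have "interior x phi \<^bold>\<and> interior y phi \<^bold>\<and> phi =
      (\<Sum>i\<in>{1..7}. \<Sum>j\<in>{1..7}. (E i [x] * E j [y]) *\<^sub>R
        (interior (f i) phi \<^bold>\<and> interior (f j) phi \<^bold>\<and> phi))"
    unfolding interior_expansion[OF ml, of x] interior_expansion[OF ml, of y]
    by (simp only: wedge_sum_left wedge_sum_right wedge_scaleR_left wedge_scaleR_right
        scaleR_sum_right scaleR_scaleR) (subst sum.swap, simp only: mult.commute)
  also have "\<dots> = (\<Sum>i\<in>{1..7}. \<Sum>j\<in>{1..7}. if i = j then (6 * (E i [x] * E j [y])) *\<^sub>R vol else 0)"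
    by (intro sum.cong refl) (simp add: phi_metric_frame)
  also have "\<dots> = (6 * metric x y) *\<^sub>R vol"
    by (simp add: metric_def sum_distrib_left scaleR_sum_left)
  finally show "(6 * metric x y) *\<^sub>R vol = interior x phi \<^bold>\<and> interior y phi \<^bold>\<and> phi" ..
qed

text \<open>Another metric inducing the same \<open>G\<^sub>2\<close>-structure is a multiple \<open>g = c\<^sup>-\<^sup>1 metric\<close>, with volume
  form \<open>c vol\<close>; since rescaling a frame by \<open>\<surd>c\<close> rescales \<open>vol\<close> by \<open>c\<^sup>7\<^sup>/\<^sup>2\<close>, this forces \<open>c\<^sup>9\<^sup>/\<^sup>2 = 1\<close>.\<close>

lemma induces_metric_unique:
  assumes "induces_metric \<omega> metric vol" "induces_metric \<omega> g v"
  shows "g = metric" "v = vol"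
proof -
  define c where "c = v (map f [1..<8])"
  have g: "inner_product g" and v: "v \<in> forms 7"
    using assms(2) dim7 unfolding induces_metric_def volume_form_def by auto
  have v_eq: "v = c *\<^sub>R vol"
    unfolding c_def by (rule top_form_eq[OF v])
  have cg: "c * g x y = metric x y" for x y
  proof -
    have "(6 * g x y) *\<^sub>R v = (6 * metric x y) *\<^sub>R vol"
      using assms unfolding induces_metric_def by metis
    from fun_cong[OF this, of "map f [1..<8]"] show ?thesis
      by (simp add: v_eq vol_frame mult.commute)
  qed
  \<comment> \<open>One nonzero vector decides the sign of \<open>c\<close>, which must be positive
    for the square root below.\<close>
  have "f 1 \<noteq> 0"
    using dual[of 1 1] linear_0[OF linear_coord[of 1]] by auto
  then have "0 < g (f 1) (f 1)"
    using g unfolding inner_product_def by blast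
  moreover have "c * g (f 1) (f 1) = 1"
    unfolding cg by (simp add: metric_frame)
  ultimately have c: "0 < c"
    by (metis zero_less_mult_pos2 zero_less_one)
  define fs where "fs = map ((*\<^sub>R) (sqrt c)) (map f [1..<8])"
  have inj: "inj ((*\<^sub>R) (sqrt c) :: 'v \<Rightarrow> 'v)"
    using c by (intro injI) simp
  have dist: "distinct fs"
    unfolding fs_def distinct_map[of "(*\<^sub>R) (sqrt c)"] using frame_list(2) inj inj_on_subset by blast
  have set: "set fs = (*\<^sub>R) (sqrt c) ` f ` {1..7}"
    unfolding fs_def set_map[of "(*\<^sub>R) (sqrt c)"] frame_list(1) ..
  have gs: "g (sqrt c *\<^sub>R x) (sqrt c *\<^sub>R y) = metric x y" for x y
  proof -
    have "linear (g x)" "linear (\<lambda>x. g x y)" for x y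
      using g by (auto simp: inner_product_def bilinear_def)
    then have "g (sqrt c *\<^sub>R x) (sqrt c *\<^sub>R y) = (sqrt c * sqrt c) * g x y"
      by (simp add: linear_scale linear_scale[of "\<lambda>x. g x _"])
    then show ?thesis
      using c cg by simp
  qed
  have "span (set fs) = UNIV"
  proof -
    have "x \<in> (*\<^sub>R) (sqrt c) ` UNIV" for x :: 'v
      using c by (intro image_eqI[of _ _ "(1 / sqrt c) *\<^sub>R x"]) auto
    moreover have "linear ((*\<^sub>R) (sqrt c) :: 'v \<Rightarrow> 'v)"
      by (rule linear_scale_self)
    ultimately show ?thesis
      unfolding set by (subst linear_span_image) (auto simp: span_frame)
  qed
  moreover have "g x y = (if x = y then 1 else 0)" if xy: "x \<in> set fs" "y \<in> set fs" for x y
  proof -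
    obtain a where a: "x = sqrt c *\<^sub>R a" "a \<in> f ` {1..7}"
      using xy(1) unfolding set by (rule imageE)
    obtain b where b: "y = sqrt c *\<^sub>R b" "b \<in> f ` {1..7}"
      using xy(2) unfolding set by (rule imageE)
    have "metric a b = (if a = b then 1 else 0)"
      using orthonormal_frame a(2) b(2) unfolding orthonormal_basis_def by blast
    then show ?thesis
      unfolding a(1) b(1) gs inj_eq[OF inj] .
  qed
  ultimately have "orthonormal_basis g (set fs)"
    unfolding orthonormal_basis_def by blast
  then have "\<bar>v fs\<bar> = 1"
    using assms(2) dist unfolding induces_metric_def volume_form_def by blast
  moreover have "v fs = sqrt c ^ 7 * c"
    using v multilinear_map_scaleR[of v "sqrt c" "map f [1..<8]"] unfolding fs_def forms_iff c_def
    by simp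
  moreover have "sqrt c ^ 7 * c = sqrt c ^ 9"
    using c power_add[of "sqrt c" 7 2] by simp
  ultimately have "sqrt c ^ 9 = 1"
    using c by simp
  then have "sqrt c = 1"
    using c power_eq_imp_eq_base[of "sqrt c" 9 1] by simp
  then have "c = 1"
    by simp
  then show "g = metric" "v = vol"
    using cg v_eq by (auto simp: fun_eq_iff)
qed

lemma g2_metric_phi: "g2_metric phi = metric"
  unfolding g2_metric_def
  using induces_metric_phi induces_metric_unique(1)[OF induces_metric_phi] by blast

lemma g2_vol_phi: "g2_vol phi = vol"
  unfolding g2_vol_def
  using induces_metric_phi induces_metric_unique(2)[OF induces_metric_phi] by blast

lemma g2_structure_phi: "g2_structure phi"
  unfolding g2_structure_def using dim7 phi_in_forms induces_metric_phi by blast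

end


section \<open>Hodge star of coframe monomials\<close>

context coframe
begin

text \<open>Each factor \<open>E i\<close> is stripped by \<open>contraction_wedge\<close>, which
  inserts \<open>f i\<close> into \<open>\<gamma>\<close> and leaves the current number of factors
  as coefficient; these multiply to the factorial.\<close>

lemma contraction_frame_wedges:
  assumes "set is \<subseteq> {1..7}" "multilinear \<gamma>" "alternating \<gamma>"
  shows "(\<Sum>fs | length fs = length is \<and> set fs \<subseteq> f ` {1..7}.
      foldr (\<^bold>\<and>) (map E is) unit_form fs * \<gamma> fs) = fact (length is) * \<gamma> (map f is)"
  using assms
proof (induction "is" arbitrary: \<gamma>)
  case Nil
  have "{fs. length fs = length [] \<and> set fs \<subseteq> f ` {1..7}} = {[]}"
    by auto
  then show ?case
    by simp
next
  case (Cons i "is")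
  have i: "i \<in> {1..7}"
    using Cons.prems(1) by simp
  have dual_sum: "(\<Sum>v\<in>f ` {1..7}. E i [v] * h v) = h (f i)" for h
  proof -
    have "(\<Sum>v\<in>f ` {1..7}. E i [v] * h v) = (\<Sum>j\<in>{1..7}. if i = j then h (f j) else 0)"
      unfolding sum.reindex[OF inj_frame] comp_def using dual[OF i] by (intro sum.cong) auto
    then show ?thesis
      using i by simp
  qed
  have "(\<Sum>fs | length fs = Suc (length is) \<and> set fs \<subseteq> f ` {1..7}.
      (E i \<^bold>\<and> foldr (\<^bold>\<and>) (map E is) unit_form) fs * \<gamma> fs) =
      (1 + real (length is)) * (\<Sum>fs | length fs = length is \<and> set fs \<subseteq> f ` {1..7}.
      foldr (\<^bold>\<and>) (map E is) unit_form fs * interior (f i) \<gamma> fs)"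
    unfolding interior_def
    by (rule contraction_wedge[OF _ one_form[OF i] _ Cons.prems(2,3)]) (simp_all only: dual_sum finite_imageI finite_atLeastAtMost)
  also have "\<dots> = (1 + real (length is)) * (fact (length is) * interior (f i) \<gamma> (map f is))"
    using Cons.prems by (subst Cons.IH) (auto intro: multilinear_interior alternating_interior)
  finally show ?case
    by (simp add: interior_def)
qed

lemma homogeneous_wedges:
  "set is \<subseteq> {1..7} \<Longrightarrow> homogeneous (length is) (foldr (\<^bold>\<and>) (map E is) unit_form)"
proof (induction "is")
  case (Cons i "is")
  then show ?case
    using homogeneous_wedge[of 1 "E i" "length is"] one_form[of i] unfolding forms_iff
    by (simp add: plus_1_eq_Suc)
qed (simp add: homogeneous_def unit_form_def)

lemma multilinear_wedges:
  "set is \<subseteq> {1..7} \<Longrightarrow> multilinear (foldr (\<^bold>\<and>) (map E is) unit_form)"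
proof (induction "is")
  case Nil
  show ?case
    by (simp add: multilinear_def unit_form_def linear_zero)
next
  case (Cons i "is")
  then show ?case
    using one_form[of i] unfolding forms_iff by (simp add: multilinear_wedge)
qed

text \<open>The factorial of the contraction cancels the one in the star, leaving \<open>vol\<close>
  with the dual vectors in its first slots.\<close>

lemma star_wedges:
  assumes "set is \<subseteq> {1..7}"
  shows "hodge_star metric vol (foldr (\<^bold>\<and>) (map E is) unit_form) xs = vol (map f is @ xs)"
proof -
  have vol: "multilinear vol" "alternating vol" "homogeneous 7 vol"
    using vol_in_forms unfolding forms_iff by auto
  have "multilinear (\<lambda>fs. vol (fs @ xs))" "alternating (\<lambda>fs. vol (fs @ xs))"
    using vol unfolding multilinear_def alternating_def append_assoc append_Cons by blast+
  note contract = contraction_frame_wedges[OF assms this]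
  let ?k = "7 - length xs"
  have "hodge_star metric vol (foldr (\<^bold>\<and>) (map E is) unit_form) xs =
      (1 / fact ?k) * (\<Sum>fs | length fs = ?k \<and> set fs \<subseteq> f ` {1..7}.
      foldr (\<^bold>\<and>) (map E is) unit_form fs * vol (fs @ xs))"
    unfolding hodge_star_frame[OF inner_product_metric orthonormal_frame
        finite_imageI[OF finite_atLeastAtMost] multilinear_wedges[OF assms] vol(1)] Let_def dim7 ..
  also have "\<dots> = vol (map f is @ xs)"
  proof (cases "?k = length is")
    case True
    then show ?thesis
      unfolding True contract by simp
  next
    case False
    \<comment> \<open>A mismatch of degrees makes both sides zero: the monomial vanishes on lists of
      length \<open>?k\<close>, and \<open>vol\<close> on a list whose length is not 7.\<close>
    then have "foldr (\<^bold>\<and>) (map E is) unit_form fs = 0" if "length fs = ?k" for fs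
      using homogeneous_wedges[OF assms] that unfolding homogeneous_def by auto
    then have "(\<Sum>fs | length fs = ?k \<and> set fs \<subseteq> f ` {1..7}.
        foldr (\<^bold>\<and>) (map E is) unit_form fs * vol (fs @ xs)) = 0"
      by (intro sum.neutral) auto
    moreover have "length (map f is @ xs) \<noteq> 7"
      using False by auto
    then have "vol (map f is @ xs) = 0"
      using vol(3) unfolding homogeneous_def by blast
    ultimately show ?thesis
      by simp
  qed
  finally show ?thesis .
qed

lemma g2_star_phi: "g2_star phi = hodge_star metric vol"
  by (simp add: g2_star_def g2_metric_phi g2_vol_phi)

lemma star_wedge3:
  assumes "i \<in> {1..7}" "j \<in> {1..7}" "k \<in> {1..7}"
  shows "g2_star phi (E i \<^bold>\<and> E j \<^bold>\<and> E k) = interior (f k) (interior (f j) (interior (f i) vol))"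
  using star_wedges[of "[i, j, k]"] assms by (simp add: g2_star_phi interior_def fun_eq_iff)

lemma star_wedge4:
  assumes "i \<in> {1..7}" "j \<in> {1..7}" "k \<in> {1..7}" "l \<in> {1..7}"
  shows "g2_star phi (E i \<^bold>\<and> E j \<^bold>\<and> E k \<^bold>\<and> E l) =
    interior (f l) (interior (f k) (interior (f j) (interior (f i) vol)))"
  using star_wedges[of "[i, j, k, l]"] assms by (simp add: g2_star_phi interior_def fun_eq_iff)

lemma star_linear:
  "g2_star phi (\<alpha> + \<beta>) = g2_star phi \<alpha> + g2_star phi \<beta>"
  "g2_star phi (\<alpha> - \<beta>) = g2_star phi \<alpha> - g2_star phi \<beta>"
  "g2_star phi (- \<alpha>) = - g2_star phi \<alpha>"
  "g2_star phi 0 = 0"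
  "g2_star phi (c *\<^sub>R \<alpha>) = c *\<^sub>R g2_star phi \<alpha>"
  by (simp_all add: g2_star_phi hodge_star_add hodge_star_diff hodge_star_minus hodge_star_zero
      hodge_star_scaleR)

text \<open>Grouped, this is E^1234 + sigma_1^+ E^67 + sigma_2^+ E^75 + sigma_3^+ E^56, with wedge
  signs omitted.\<close>

lemma g2_psi_phi:
  "g2_psi phi = E 1 \<^bold>\<and> E 2 \<^bold>\<and> E 3 \<^bold>\<and> E 4 + E 1 \<^bold>\<and> E 3 \<^bold>\<and> E 6 \<^bold>\<and> E 7 - E 2 \<^bold>\<and> E 4 \<^bold>\<and> E 6 \<^bold>\<and> E 7
     + E 1 \<^bold>\<and> E 4 \<^bold>\<and> E 5 \<^bold>\<and> E 7 + E 2 \<^bold>\<and> E 3 \<^bold>\<and> E 5 \<^bold>\<and> E 7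
     + E 1 \<^bold>\<and> E 2 \<^bold>\<and> E 5 \<^bold>\<and> E 6 + E 3 \<^bold>\<and> E 4 \<^bold>\<and> E 5 \<^bold>\<and> E 6"
proof -
  have "g2_psi phi = g2_star phi (E 1 \<^bold>\<and> E 3 \<^bold>\<and> E 5 - E 2 \<^bold>\<and> E 4 \<^bold>\<and> E 5 - E 1 \<^bold>\<and> E 4 \<^bold>\<and> E 6
      - E 2 \<^bold>\<and> E 3 \<^bold>\<and> E 6 + E 1 \<^bold>\<and> E 2 \<^bold>\<and> E 7 + E 3 \<^bold>\<and> E 4 \<^bold>\<and> E 7 + E 5 \<^bold>\<and> E 6 \<^bold>\<and> E 7)"
    \<comment> \<open>Expanding only the argument keeps \<open>g2_star phi\<close> in the form that
      the evaluation rules expect.\<close>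
    unfolding g2_psi_def by (rule arg_cong[OF phi_def])
  then show ?thesis
    by (simp add: star_linear star_wedge3 vol_def interior_frame)
qed

end


section \<open>The exterior derivative\<close>

text \<open>The Lie derivative of left-invariant forms along the left-invariant field
  \<open>x\<close>; it is the auxiliary operator of Cartan's formula.\<close>

definition lie_derivative ::
    "('v \<Rightarrow> 'v \<Rightarrow> 'v) \<Rightarrow> 'v \<Rightarrow> ('v, real) form \<Rightarrow> ('v, real) form" where
  "lie_derivative br x \<omega> = (\<lambda>xs. - (\<Sum>j<length xs. \<omega> (xs[j := br x (xs ! j)])))"

lemma lie_derivative_Nil [simp]: "lie_derivative br x \<omega> [] = 0"
  by (simp add: lie_derivative_def)

lemma lie_derivative_Cons:
  "lie_derivative br x \<omega> (y # ys) = lie_derivative br x (interior y \<omega>) ys - \<omega> (br x y # ys)"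
  by (simp add: lie_derivative_def interior_def sum.lessThan_Suc_shift del: sum.lessThan_Suc)

text \<open>The commutator relation [L_x, i_y] = i_[x,y], which closes the induction for the product
  rule.\<close>

lemma interior_lie_derivative:
  "interior y (lie_derivative br x \<omega>) =
     lie_derivative br x (interior y \<omega>) - interior (br x y) \<omega>"
  by (simp add: interior_def[of _ "lie_derivative br x \<omega>"] lie_derivative_Cons fun_eq_iff)
    (simp add: interior_def)

lemma lie_derivative_add: "lie_derivative br x (\<alpha> + \<beta>) = lie_derivative br x \<alpha> + lie_derivative br x \<beta>"
  by (simp add: lie_derivative_def fun_eq_iff sum.distrib)

lemma grade_inv_lie_derivative:
  "grade_inv (lie_derivative br x \<omega>) = lie_derivative br x (grade_inv \<omega>)"
  by (simp add: lie_derivative_def grade_inv_def fun_eq_iff sum_distrib_left)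

lemma lie_derivative_wedge:
  "lie_derivative br x (\<alpha> \<^bold>\<and> \<beta>) = lie_derivative br x \<alpha> \<^bold>\<and> \<beta> + \<alpha> \<^bold>\<and> lie_derivative br x \<beta>"
proof
  fix xs
  show "lie_derivative br x (\<alpha> \<^bold>\<and> \<beta>) xs = (lie_derivative br x \<alpha> \<^bold>\<and> \<beta> + \<alpha> \<^bold>\<and> lie_derivative br x \<beta>) xs"
  proof (induction xs arbitrary: \<alpha> \<beta>)
    case (Cons y ys)
    then show ?case
      by (simp add: lie_derivative_Cons interior_wedge lie_derivative_add wedge_Cons
          interior_lie_derivative grade_inv_lie_derivative)
  qed simp
qed

section \<open>Cartan's formula and the graded Leibniz rule\<close>

lemma ext_d_Nil [simp]: "ext_d br \<omega> [] = 0"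
  by (simp add: ext_d_def)

lemma ext_d_add: "ext_d br (\<alpha> + \<beta>) = ext_d br \<alpha> + ext_d br \<beta>"
  and ext_d_diff: "ext_d br (\<alpha> - \<beta>) = ext_d br \<alpha> - ext_d br \<beta>"
  and ext_d_minus: "ext_d br (- \<alpha>) = - ext_d br \<alpha>"
  and ext_d_zero: "ext_d br 0 = 0"
  and ext_d_scaleR: "ext_d br (c *\<^sub>R \<alpha>) = c *\<^sub>R ext_d br \<alpha>"
  for \<alpha> \<beta> :: "('v, 'b::real_vector) form"
  unfolding ext_d_def case_prod_unfold
  by (simp_all add: fun_eq_iff scaleR_add_right scaleR_diff_right sum.distrib sum_subtractf sum_negf
      scaleR_sum_right mult.commute)

lemma nths_Compl_singleton: "j < length xs \<Longrightarrow> nths xs (- {j}) = take j xs @ drop (Suc j) xs"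
proof (induction xs arbitrary: j)
  case (Cons x xs)
  show ?case
  proof (cases j)
    case 0
    then show ?thesis
      by (simp add: nths_Cons nths_all)
  next
    case (Suc j')
    then have "{i. Suc i \<in> - {j}} = - {j'}"
      by auto
    then show ?thesis
      using Cons Suc by (simp add: nths_Cons)
  qed
qed simp

text \<open>Cartan's formula L_x = d i_x + i_x d. The pairs of positions summed in
  \<open>ext_d\<close> are split by whether the first one is that of \<open>x\<close>.\<close>

lemma interior_ext_d:
  fixes \<omega> :: "('v, real) form"
  assumes "alternating \<omega>"
  shows "interior x (ext_d br \<omega>) = lie_derivative br x \<omega> - ext_d br (interior x \<omega>)"
proof
  fix xs :: "'v list"
  let ?n = "length xs"
  let ?P = "{(i, j). i < j \<and> j < ?n}"
  let ?h = "\<lambda>(i, j). (- 1) ^ (i + j) * \<omega> (br ((x # xs) ! i) ((x # xs) ! j) # nths (x # xs) (- {i, j}))"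
  have split: "{(i, j). i < j \<and> j < Suc ?n} = (\<lambda>j. (0, Suc j)) ` {..<?n} \<union> map_prod Suc Suc ` ?P"
  proof (intro set_eqI iffI)
    fix p
    assume "p \<in> {(i, j). i < j \<and> j < Suc ?n}"
    then obtain i j where p: "p = (i, Suc j)" "i \<le> j" "j < ?n"
      by (cases p; cases "snd p") auto
    then show "p \<in> (\<lambda>j. (0, Suc j)) ` {..<?n} \<union> map_prod Suc Suc ` ?P"
      by (cases i) (auto simp: image_iff)
  qed auto
  have "?P \<subseteq> {..<?n} \<times> {..<?n}"
    by auto
  then have fin: "finite ?P"
    by (rule finite_subset) simp
  \<comment> \<open>The bracket stands in front and has to travel back to position \<open>j\<close>;
    this costs (-1)^j and cancels the sign (-1)^(j+1) up to one minus.\<close>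
  have first: "?h (0, Suc j) = - \<omega> (xs[j := br x (xs ! j)])" if "j < ?n" for j
  proof -
    have "{i. Suc i \<in> - {0, Suc j}} = - {j}"
      by auto
    then have "?h (0, Suc j) = - ((- 1) ^ j * \<omega> (br x (xs ! j) # take j xs @ drop (Suc j) xs))"
      using that by (simp add: nths_Cons nths_Compl_singleton)
    also have "\<dots> = - \<omega> (take j xs @ br x (xs ! j) # drop (Suc j) xs)"
      using that by (simp add: alternating_move[OF assms])
    also have "\<dots> = - \<omega> (xs[j := br x (xs ! j)])"
      using that by (simp add: upd_conv_take_nth_drop)
    finally show ?thesis .
  qed
  \<comment> \<open>Shifting both positions by one preserves the sign; the minus comes from
    exchanging the bracket with \<open>x\<close>, which \<open>interior x\<close> puts in
    front.\<close>
  have second: "?h (Suc i, Suc j) =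
      - ((- 1) ^ (i + j) * interior x \<omega> (br (xs ! i) (xs ! j) # nths xs (- {i, j})))" for i j
  proof -
    have "{k. Suc k \<in> - {Suc i, Suc j}} = - {i, j}"
      by auto
    moreover have "\<omega> ([] @ y # x # ys) = - \<omega> ([] @ x # y # ys)" for y ys
      using assms unfolding alternating_def by blast
    ultimately show ?thesis
      by (simp add: nths_Cons interior_def)
  qed
  have "ext_d br \<omega> (x # xs) = (\<Sum>p\<in>{(i, j). i < j \<and> j < Suc ?n}. ?h p)"
    by (simp add: ext_d_def case_prod_unfold)
  also have "\<dots> = (\<Sum>j<?n. ?h (0, Suc j)) + (\<Sum>p\<in>?P. ?h (map_prod Suc Suc p))"
    unfolding split
    by (subst sum.union_disjoint) (auto simp: fin sum.reindex inj_on_def)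
  also have "(\<Sum>j<?n. ?h (0, Suc j)) = lie_derivative br x \<omega> xs"
    using first by (simp add: lie_derivative_def sum_negf)
  also have "(\<Sum>p\<in>?P. ?h (map_prod Suc Suc p)) = - ext_d br (interior x \<omega>) xs"
    unfolding ext_d_def sum_negf[symmetric]
    by (intro sum.cong refl) (simp only: split_paired_all map_prod_simp prod.case real_scaleR_def,
        rule second[simplified prod.case])
  finally show "interior x (ext_d br \<omega>) xs = (lie_derivative br x \<omega> - ext_d br (interior x \<omega>)) xs"
    by (simp add: interior_def)
qed

text \<open>A degree-free way of saying that \<open>ext_d\<close> raises the degree by one.\<close>

lemma grade_inv_ext_d:
  assumes "alternating \<omega>"
  shows "grade_inv (ext_d br \<omega>) = - ext_d br (grade_inv \<omega>)"
proof
  fix xs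
  show "grade_inv (ext_d br \<omega>) xs = (- ext_d br (grade_inv \<omega>)) xs"
    using assms
  proof (induction xs arbitrary: \<omega>)
    case (Cons x xs)
    have "grade_inv (ext_d br \<omega>) (x # xs) = interior x (grade_inv (ext_d br \<omega>)) xs"
      by (simp only: interior_def)
    also have "\<dots> = - lie_derivative br x (grade_inv \<omega>) xs + grade_inv (ext_d br (interior x \<omega>)) xs"
      by (simp add: interior_ext_d Cons.prems grade_inv_lie_derivative)
    also have "\<dots> = - interior x (ext_d br (grade_inv \<omega>)) xs"
      by (simp add: Cons.IH interior_ext_d Cons.prems alternating_grade_inv alternating_interior
          ext_d_minus)
    finally show ?case
      by (simp add: interior_def)
  qed simp
qed

text \<open>After contraction with the first argument, Cartan's formula reduces the claim to the
  product rule for the Lie derivative and the same claim for contracted factors.\<close>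

lemma ext_d_wedge:
  assumes "alternating \<alpha>" "alternating \<beta>"
  shows "ext_d br (\<alpha> \<^bold>\<and> \<beta>) = ext_d br \<alpha> \<^bold>\<and> \<beta> + grade_inv \<alpha> \<^bold>\<and> ext_d br \<beta>"
proof
  fix xs
  show "ext_d br (\<alpha> \<^bold>\<and> \<beta>) xs = (ext_d br \<alpha> \<^bold>\<and> \<beta> + grade_inv \<alpha> \<^bold>\<and> ext_d br \<beta>) xs"
    using assms
  proof (induction xs arbitrary: \<alpha> \<beta>)
    case (Cons x xs)
    have "ext_d br (\<alpha> \<^bold>\<and> \<beta>) (x # xs) = interior x (ext_d br (\<alpha> \<^bold>\<and> \<beta>)) xs"
      by (simp only: interior_def)
    also have "\<dots> = interior x (ext_d br \<alpha> \<^bold>\<and> \<beta> + grade_inv \<alpha> \<^bold>\<and> ext_d br \<beta>) xs"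
      using Cons.prems
      by (simp add: interior_ext_d alternating_wedge lie_derivative_wedge interior_wedge ext_d_add
          Cons.IH alternating_interior alternating_grade_inv grade_inv_ext_d)
    finally show ?case
      by (simp only: interior_def)
  qed simp
qed


section \<open>Torsion of the family\<close>

text \<open>The rows of \<open>C\<close> are the coefficients of dE^5, dE^6, dE^7. A full matrix is
  allowed because a rotation mixes diagonal structure equations.\<close>

locale nilpotent_coframe = coframe E f
  for E :: "nat \<Rightarrow> ('v::real_vector, real) form" and f :: "nat \<Rightarrow> 'v" +
  fixes br :: "'v \<Rightarrow> 'v \<Rightarrow> 'v" and C :: "real ^ 3 ^ 3"
  assumes closed: "i \<in> {1..4} \<Longrightarrow> ext_d br (E i) = 0"
    and dE5: "ext_d br (E 5) = C $ 1 $ 1 *\<^sub>R sigma1_minus E + C $ 1 $ 2 *\<^sub>R sigma2_minus E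
      + C $ 1 $ 3 *\<^sub>R sigma3_minus E"
    and dE6: "ext_d br (E 6) = C $ 2 $ 1 *\<^sub>R sigma1_minus E + C $ 2 $ 2 *\<^sub>R sigma2_minus E
      + C $ 2 $ 3 *\<^sub>R sigma3_minus E"
    and dE7: "ext_d br (E 7) = C $ 3 $ 1 *\<^sub>R sigma1_minus E + C $ 3 $ 2 *\<^sub>R sigma2_minus E
      + C $ 3 $ 3 *\<^sub>R sigma3_minus E"
begin

lemma alternating_coframe: "i \<in> {1..7} \<Longrightarrow> alternating (E i)"
  using one_form forms_iff by blast

lemma ext_d_wedge_coframe:
  "i \<in> {1..7} \<Longrightarrow> alternating \<omega> \<Longrightarrow>
    ext_d br (E i \<^bold>\<and> \<omega>) = ext_d br (E i) \<^bold>\<and> \<omega> - E i \<^bold>\<and> ext_d br \<omega>"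
  by (simp add: ext_d_wedge alternating_coframe grade_inv_one_form[OF one_form])

lemmas ext_d_simps = ext_d_add ext_d_diff ext_d_minus ext_d_zero ext_d_scaleR
  ext_d_wedge_coframe alternating_wedge alternating_coframe closed dE5 dE6 dE7

lemmas sigma_minus_defs = sigma1_minus_def sigma2_minus_def sigma3_minus_def

lemma ext_d_phi:
  "ext_d br phi = ext_d br (E 5) \<^bold>\<and> E 6 \<^bold>\<and> E 7 - ext_d br (E 6) \<^bold>\<and> E 5 \<^bold>\<and> E 7
     + ext_d br (E 7) \<^bold>\<and> E 5 \<^bold>\<and> E 6"
  unfolding phi_def
  by (simp add: ext_d_simps sigma_minus_defs wedge_sort algebra_simps)

text \<open>Anti-self-duality on the horizontal four-space: the star sends sigma_j^- E^67 to
  -sigma_j^- E^5, and cyclically.\<close>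

lemma star_ext_d_phi:
  "g2_star phi (ext_d br phi) =
     - (ext_d br (E 5) \<^bold>\<and> E 5 + ext_d br (E 6) \<^bold>\<and> E 6 + ext_d br (E 7) \<^bold>\<and> E 7)"
  unfolding ext_d_phi dE5 dE6 dE7
  by (simp add: sigma_minus_defs star_linear star_wedge4 vol_def interior_frame wedge_sort
      algebra_simps)

text \<open>Each term of d phi has a factor sigma_j^- and two of E^5, E^6, E^7. The former
  annihilates every sigma_i^+, the latter annihilate E^567.\<close>

lemma ext_d_phi_wedge_phi: "ext_d br phi \<^bold>\<and> phi = 0"
  unfolding ext_d_phi dE5 dE6 dE7
  by (simp add: phi_def sigma_minus_defs wedge_sort)

lemma tau0_phi: "tau0 br phi = 0"
  by (simp add: tau0_def ext_d_phi_wedge_phi star_linear)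

lemma tau1_phi: "tau1 br phi = 0"
proof -
  have "phi \<^bold>\<and> g2_star phi (ext_d br phi) = 0"
    unfolding star_ext_d_phi dE5 dE6 dE7
    by (simp add: phi_def sigma_minus_defs wedge_sort)
  then show ?thesis
    by (simp add: tau1_def star_linear)
qed

text \<open>Differentiating a vertical factor next to sigma_i^+ produces sigma_i^+ wedge sigma_j^-,
  which is zero; the horizontal factors are closed.\<close>

lemma ext_d_psi: "ext_d br (g2_psi phi) = 0"
  unfolding g2_psi_phi
  by (simp add: ext_d_simps sigma_minus_defs wedge_sort)

lemma purely_co_closed_phi: "purely_co_closed br phi"
  by (simp add: purely_co_closed_def co_closed_def ext_d_psi tau0_phi)

lemma torsion_phi:
  "g2_torsion br phi = ext_d br (E 5) \<^bold>\<and> E 5 + ext_d br (E 6) \<^bold>\<and> E 6 + ext_d br (E 7) \<^bold>\<and> E 7"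
  unfolding g2_torsion_def ext_d_phi_wedge_phi tau1_phi star_ext_d_phi
  by (simp add: star_linear)

text \<open>The sigma_j^- are closed, mutually orthogonal under the wedge product, and each squares
  to -2 E^1234, so the squared entries of \<open>C\<close> add up.\<close>

lemma ext_d_torsion:
  "ext_d br (g2_torsion br phi) =
     (- 2 * (\<Sum>i\<in>UNIV. \<Sum>j\<in>UNIV. (C $ i $ j)\<^sup>2)) *\<^sub>R (E 1 \<^bold>\<and> E 2 \<^bold>\<and> E 3 \<^bold>\<and> E 4)"
  unfolding torsion_phi dE5 dE6 dE7
  by (simp add: ext_d_simps sigma_minus_defs wedge_sort)
    (simp add: fun_eq_iff sum_3 power2_eq_square algebra_simps)

end


section \<open>Vectors dual to a basis of one-forms\<close>

lemma linear_form:
  assumes "linear h"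
  shows "(\<lambda>xs. if length xs = 1 then h (hd xs) else 0) \<in> forms 1"
  using assms unfolding forms_def by (auto simp: length_Suc_conv)

text \<open>The coordinate functionals of an auxiliary basis \<open>S\<close> are expanded in
  \<open>e\<close>; the coefficients then assemble the dual vectors.\<close>

lemma dual_basis_frame:
  fixes e :: "nat \<Rightarrow> ('v::real_vector, real) form"
  assumes e: "dual_basis 7 e" and dim: "dim (UNIV :: 'v set) = 7"
  obtains f where "coframe e f"
proof -
  have inj: "inj_on e {1..7}" and indep: "independent (e ` {1..7})"
    and span: "span (e ` {1..7}) = forms 1"
    using e by (auto simp: dual_basis_def)
  have one: "e i \<in> forms 1" if "i \<in> {1..7}" for i
    unfolding span[symmetric] using that by (intro span_base imageI)
  have lin: "linear (\<lambda>x. e i [x])" if "i \<in> {1..7}" for i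
    using one[OF that] multilinear_linear unfolding forms_iff by blast
  obtain S :: "'v set" where S: "independent S" "UNIV \<subseteq> span S" "card S = dim (UNIV :: 'v set)"
    by (rule basis_exists[of UNIV])
  have fin: "finite S"
    using S(3) dim by (intro card_ge_0_finite) simp
  have S_UNIV: "x \<in> span S" for x
    using S(2) by blast
  define w where "w b = (\<lambda>xs. if length xs = 1 then representation S (hd xs) b else 0)" for b
  have w_form: "w b \<in> forms 1" for b
    unfolding w_def
    by (intro linear_form linearI) (simp_all add: representation_add representation_scale S S_UNIV)
  have "\<exists>m. w b = (\<Sum>l\<in>{1..7}. m l *\<^sub>R e l)" for b
  proof -
    have "w b \<in> range (\<lambda>u. \<Sum>v\<in>e ` {1..7}. u v *\<^sub>R v)"
      unfolding span_finite[OF finite_imageI[OF finite_atLeastAtMost], symmetric] span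
      by (rule w_form)
    then obtain u where "w b = (\<Sum>v\<in>e ` {1..7}. u v *\<^sub>R v)"
      by (rule rangeE)
    then have "w b = (\<Sum>l\<in>{1..7}. u (e l) *\<^sub>R e l)"
      unfolding sum.reindex[OF inj] comp_def .
    then show ?thesis
      by (rule exI[of _ "\<lambda>l. u (e l)"])
  qed
  then obtain m where m: "w b = (\<Sum>l\<in>{1..7}. m b l *\<^sub>R e l)" for b
    by metis
  \<comment> \<open>The coefficients of e^j in the coordinate functionals are the coordinates of the
    sought \<open>f j\<close>.\<close>
  define f where "f j = (\<Sum>b\<in>S. m b j *\<^sub>R b)" for j
  have f: "e k [f j] = (\<Sum>b\<in>S. m b j * e k [b])" if "k \<in> {1..7}" for k j
    unfolding f_def by (simp add: linear_sum[OF lin[OF that]] linear_scale[OF lin[OF that]])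
  have e_eq: "e k = (\<Sum>l\<in>{1..7}. e k [f l] *\<^sub>R e l)" if k: "k \<in> {1..7}" for k
  proof (rule form_eqI)
    have sum_apply: "(\<Sum>l\<in>{1..7}. c l *\<^sub>R e l) xs = (\<Sum>l\<in>{1..7}. c l * e l xs)" for c xs
      by (subst sum_comp_morphism[of "\<lambda>\<eta>. \<eta> xs", symmetric]) simp_all
    show "e k [] = (\<Sum>l\<in>{1..7}. e k [f l] *\<^sub>R e l) []"
      unfolding sum_apply using one_form_Nil[OF one] k by simp
    fix x
    have "e k [x] = e k [\<Sum>b\<in>S. representation S x b *\<^sub>R b]"
      using sum_representation_eq[OF S(1) S_UNIV fin order_refl, of x] by simp
    also have "\<dots> = (\<Sum>b\<in>S. w b [x] * e k [b])"
      by (simp add: linear_sum[OF lin[OF k]] linear_scale[OF lin[OF k]] w_def)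
    also have "\<dots> = (\<Sum>b\<in>S. \<Sum>l\<in>{1..7}. m b l * e l [x] * e k [b])"
      unfolding m sum_apply sum_distrib_right ..
    also have "\<dots> = (\<Sum>l\<in>{1..7}. \<Sum>b\<in>S. m b l * e l [x] * e k [b])"
      by (rule sum.swap)
    also have "\<dots> = (\<Sum>l\<in>{1..7}. e k [f l] * e l [x])"
      unfolding f[OF k] sum_distrib_right by (simp only: mult_ac)
    also have "\<dots> = (\<Sum>l\<in>{1..7}. e k [f l] *\<^sub>R e l) [x]"
      by (rule sum_apply[symmetric])
    moreover have "(\<Sum>l\<in>{1..7}. e k [f l] *\<^sub>R e l) \<in> forms 1"
      unfolding span[symmetric] by (intro span_sum span_scale span_base imageI)
    ultimately show "interior x (e k) = interior x (\<Sum>l\<in>{1..7}. e k [f l] *\<^sub>R e l)"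
      using one[OF k] by (simp only: interior_one_form)
  qed
  have "e k [f l] = (if k = l then 1 else 0)" if k: "k \<in> {1..7}" and l: "l \<in> {1..7}" for k l
  proof (rule ccontr)
    assume neq: "\<not> ?thesis"
    \<comment> \<open>These are the coefficients of the relation obtained by subtracting
      \<open>e k\<close> from its own expansion, indexed by the forms themselves.\<close>
    define u where "u v = e k [f (the_inv_into {1..7} e v)] - (if v = e k then 1 else 0)" for v
    have inv: "the_inv_into {1..7} e (e i) = i" if "i \<in> {1..7}" for i
      by (rule the_inv_into_f_f[OF inj that])
    have "(\<Sum>v\<in>e ` {1..7}. u v *\<^sub>R v) = (\<Sum>i\<in>{1..7}. e k [f i] *\<^sub>R e i - (if i = k then e k else 0))"
      unfolding sum.reindex[OF inj] comp_def u_def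
      using inj_on_eq_iff[OF inj _ k] by (intro sum.cong refl) (simp add: inv scaleR_left_diff_distrib del: One_nat_def)
    also have "\<dots> = 0"
      unfolding sum_subtractf e_eq[OF k, symmetric] using k by simp
    finally have "u (e l) = 0"
      using indep l unfolding dependent_finite[OF finite_imageI[OF finite_atLeastAtMost]] by blast
    then show False
      using neq inj_on_eq_iff[OF inj l k] unfolding u_def inv[OF l] by auto
  qed
  then have "coframe e f"
    by unfold_locales (use dim one in auto)
  then show ?thesis
    by (rule that)
qed


section \<open>Curvature of the connection\<close>

text \<open>Sums of such decomposable forms reduce vector-valued wedge products to scalar
  ones.\<close>

definition tensor_form :: "('v, real) form \<Rightarrow> 'b::real_vector \<Rightarrow> ('v, 'b) form" (infixl "\<^bold>\<otimes>" 70)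
  where "\<omega> \<^bold>\<otimes> y = (\<lambda>xs. \<omega> xs *\<^sub>R y)"

lemma ext_d_tensor: "ext_d br (\<omega> \<^bold>\<otimes> y) = ext_d br \<omega> \<^bold>\<otimes> y"
  by (simp add: ext_d_def tensor_form_def fun_eq_iff scaleR_sum_left case_prod_unfold)

lemma wedge_by_tensor:
  assumes "bilinear m"
  shows "wedge_by m (\<alpha> \<^bold>\<otimes> y) (\<beta> \<^bold>\<otimes> z) = (\<alpha> \<^bold>\<and> \<beta>) \<^bold>\<otimes> m y z"
  by (simp add: wedge_by_def tensor_form_def fun_eq_iff scaleR_sum_left mult.commute
      bilinear_lmul[OF assms] bilinear_rmul[OF assms])

lemma wedge_by_add:
  assumes "bilinear m"
  shows "wedge_by m (\<alpha> + \<alpha>') \<beta> = wedge_by m \<alpha> \<beta> + wedge_by m \<alpha>' \<beta>"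
    and "wedge_by m \<alpha> (\<beta> + \<beta>') = wedge_by m \<alpha> \<beta> + wedge_by m \<alpha> \<beta>'"
  by (simp_all add: wedge_by_def fun_eq_iff sum.distrib scaleR_add_right
      bilinear_ladd[OF assms] bilinear_radd[OF assms])

lemma tensor_add: "(\<alpha> + \<beta>) \<^bold>\<otimes> y = \<alpha> \<^bold>\<otimes> y + \<beta> \<^bold>\<otimes> y"
  and tensor_minus: "(- \<alpha>) \<^bold>\<otimes> y = - (\<alpha> \<^bold>\<otimes> y)"
  and tensor_zero: "0 \<^bold>\<otimes> y = 0"
  and tensor_scaleR: "(c *\<^sub>R \<alpha>) \<^bold>\<otimes> y = c *\<^sub>R (\<alpha> \<^bold>\<otimes> y)"
  and tensor_scaleR_right: "\<alpha> \<^bold>\<otimes> (c *\<^sub>R y) = c *\<^sub>R (\<alpha> \<^bold>\<otimes> y)"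
  and tensor_minus_right: "\<alpha> \<^bold>\<otimes> (- y) = - (\<alpha> \<^bold>\<otimes> y)"
  and tensor_zero_right: "\<alpha> \<^bold>\<otimes> 0 = 0"
  by (simp_all add: tensor_form_def fun_eq_iff scaleR_add_left scaleR_left_commute)

lemma connection_form_tensor: "connection_form e Y5 Y6 Y7 = e 5 \<^bold>\<otimes> Y5 + e 6 \<^bold>\<otimes> Y6 + e 7 \<^bold>\<otimes> Y7"
  by (simp add: connection_form_def tensor_form_def fun_eq_iff)

lemma lie_algebra_skew:
  assumes "lie_algebra lb"
  shows "lb y x = - lb x y"
proof -
  have bil: "bilinear lb" and alt: "lb z z = 0" for z
    using assms by (auto simp: lie_algebra_def)
  have "lb x y + lb y x = 0"
    using alt[of "x + y"] unfolding bilinear_ladd[OF bil] bilinear_radd[OF bil]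
    by (simp add: alt add.commute)
  then show ?thesis
    unfolding eq_neg_iff_add_eq_0 by (subst add.commute)
qed

text \<open>In [A wedge A] each unordered pair of basis vectors occurs twice with the same value,
  bracket and wedge both being skew; this absorbs the factor 1/2.\<close>

lemma curvature_connection_form:
  assumes lie: "lie_algebra lb" and one: "e 5 \<in> forms 1" "e 6 \<in> forms 1" "e 7 \<in> forms 1"
    and lb: "lb Y6 Y7 = lam5 *\<^sub>R Y5" "lb Y7 Y5 = lam6 *\<^sub>R Y6" "lb Y5 Y6 = lam7 *\<^sub>R Y7"
  shows "curvature br lb (connection_form e Y5 Y6 Y7) =
    (ext_d br (e 5) + lam5 *\<^sub>R (e 6 \<^bold>\<and> e 7)) \<^bold>\<otimes> Y5 +
    (ext_d br (e 6) + lam6 *\<^sub>R (e 7 \<^bold>\<and> e 5)) \<^bold>\<otimes> Y6 +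
    (ext_d br (e 7) + lam7 *\<^sub>R (e 5 \<^bold>\<and> e 6)) \<^bold>\<otimes> Y7"
proof -
  have bil: "bilinear lb" and alt: "lb x x = 0" for x
    using lie by (auto simp: lie_algebra_def)
  note swap = lie_algebra_skew[OF lie]
  have lb': "lb Y7 Y6 = - (lam5 *\<^sub>R Y5)" "lb Y5 Y7 = - (lam6 *\<^sub>R Y6)" "lb Y6 Y5 = - (lam7 *\<^sub>R Y7)"
    using lb swap by metis+
  have wedge': "e 7 \<^bold>\<and> e 6 = - (e 6 \<^bold>\<and> e 7)" "e 5 \<^bold>\<and> e 7 = - (e 7 \<^bold>\<and> e 5)" "e 6 \<^bold>\<and> e 5 = - (e 5 \<^bold>\<and> e 6)"
    by (intro one_form_wedge_swap one)+
  have "wedge_by lb (connection_form e Y5 Y6 Y7) (connection_form e Y5 Y6 Y7) =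
      2 *\<^sub>R ((lam5 *\<^sub>R (e 6 \<^bold>\<and> e 7)) \<^bold>\<otimes> Y5 + (lam6 *\<^sub>R (e 7 \<^bold>\<and> e 5)) \<^bold>\<otimes> Y6 +
        (lam7 *\<^sub>R (e 5 \<^bold>\<and> e 6)) \<^bold>\<otimes> Y7)"
    by (simp add: connection_form_tensor wedge_by_add[OF bil] wedge_by_tensor[OF bil] alt lb lb' wedge'
        tensor_minus tensor_zero_right tensor_scaleR tensor_scaleR_right tensor_minus_right
        scaleR_2 add_ac)
  then show ?thesis
    by (simp add: curvature_def connection_form_tensor ext_d_add ext_d_tensor tensor_add)
qed

lemma tensor_basis_eq_0:
  assumes Y: "distinct [Y5, Y6, Y7]" "independent {Y5, Y6, Y7}"
    and zero: "\<alpha> \<^bold>\<otimes> Y5 + \<beta> \<^bold>\<otimes> Y6 + \<gamma> \<^bold>\<otimes> Y7 = 0"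
  shows "\<alpha> = 0" "\<beta> = 0" "\<gamma> = 0"
proof -
  have ne: "Y6 \<noteq> Y5" "Y7 \<noteq> Y5" "Y7 \<noteq> Y6"
    using Y(1) by auto
  have "\<alpha> xs = 0 \<and> \<beta> xs = 0 \<and> \<gamma> xs = 0" for xs
  proof -
    define u where "u v = (if v = Y5 then \<alpha> xs else if v = Y6 then \<beta> xs else \<gamma> xs)" for v
    have "(\<Sum>v\<in>{Y5, Y6, Y7}. u v *\<^sub>R v) = 0"
      using Y(1) fun_cong[OF zero, of xs] by (simp add: u_def tensor_form_def add.assoc ne)
    then have "\<forall>v\<in>{Y5, Y6, Y7}. u v = 0"
      using Y(2) unfolding dependent_finite[of "{Y5, Y6, Y7}", simplified] by blast
    then show ?thesis
      using Y(1) by (auto simp: u_def split: if_splits)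
  qed
  then show "\<alpha> = 0" "\<beta> = 0" "\<gamma> = 0"
    by (auto simp: fun_eq_iff)
qed


section \<open>Pairings on a three-dimensional space\<close>

text \<open>The Gram matrix in the basis \<open>Y5, Y6, Y7\<close> has diagonal entries \<open>1\<close> and off-diagonal entries
  \<open>x\<close>, hence eigenvalues \<open>1 + 2x, 1 - x, 1 - x\<close>; the three signatures come from \<open>x = 0, 2, -2\<close>.\<close>

lemma pairing_exists:
  fixes Y5 Y6 Y7 :: "'g::real_vector"
  assumes Y: "distinct [Y5, Y6, Y7]" "independent {Y5, Y6, Y7}" "span {Y5, Y6, Y7} = UNIV"
    and ab: "abelian_lie lb" and sig: "(p, q) \<in> {(3, 0), (1, 2), (2, 1)}"
  obtains K where "invariant_pairing lb K" "has_signature K p q"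
    "K Y5 Y5 = 1" "K Y6 Y6 = 1" "K Y7 Y7 = 1"
proof -
  let ?Y = "{Y5, Y6, Y7}"
  have ne: "Y6 \<noteq> Y5" "Y7 \<noteq> Y5" "Y7 \<noteq> Y6" "Y5 \<noteq> Y6" "Y5 \<noteq> Y7" "Y6 \<noteq> Y7"
    using Y(1) by auto
  define a where "a i v = representation ?Y v i" for v i
  have lin: "a i (v + w) = a i v + a i w" "a i (c *\<^sub>R v) = c * a i v" for i v w c
    using Y by (simp_all add: a_def representation_add representation_scale)
  have a_Y: "a i v = (if v = i then 1 else 0)" if "v \<in> ?Y" for i v
    using representation_basis[OF Y(2) that] by (auto simp: a_def)
  have expand: "v = a Y5 v *\<^sub>R Y5 + a Y6 v *\<^sub>R Y6 + a Y7 v *\<^sub>R Y7" for v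
    using sum_representation_eq[OF Y(2) _ _ order_refl, of v] Y by (simp add: a_def add.assoc)
  obtain x :: real where x: "(p, q, x) \<in> {(3, 0, 0), (1, 2, 2), (2, 1, - 2)}"
    using sig by auto
  define K where "K v w = (1 - x) * (a Y5 v * a Y5 w + a Y6 v * a Y6 w + a Y7 v * a Y7 w)
    + x * ((a Y5 v + a Y6 v + a Y7 v) * (a Y5 w + a Y6 w + a Y7 w))" for v w
  have bil: "bilinear K"
    unfolding bilinear_def by (auto intro!: linearI simp: K_def lin algebra_simps)
  have sym: "K v w = K w v" for v w
    by (simp add: K_def mult.commute)
  have K_Y: "K v w = (if v = w then 1 else x)" if "v \<in> ?Y" "w \<in> ?Y" for v w
    using that Y(1) by (auto simp: K_def a_Y)
  have nondeg: "v = 0" if "\<forall>w. K v w = 0" for v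
  proof -
    have "K v Y5 = 0" "K v Y6 = 0" "K v Y7 = 0"
      using that by auto
    then have "(1 - x) * a Y5 v + x * (a Y5 v + a Y6 v + a Y7 v) = 0"
      "(1 - x) * a Y6 v + x * (a Y5 v + a Y6 v + a Y7 v) = 0"
      "(1 - x) * a Y7 v + x * (a Y5 v + a Y6 v + a Y7 v) = 0"
      by (simp_all add: K_def a_Y ne)
    \<comment> \<open>The determinant of this system is (1 - x)^2 (1 + 2x), nonzero for the three
      values of \<open>x\<close>.\<close>
    then have "a Y5 v = 0 \<and> a Y6 v = 0 \<and> a Y7 v = 0"
      using x by auto
    then show ?thesis
      using expand[of v] by simp
  qed
  have inv: "invariant_pairing lb K"
    using ab bil sym nondeg bilinear_lzero[OF bil] bilinear_rzero[OF bil]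
    unfolding invariant_pairing_def abelian_lie_def by auto
  \<comment> \<open>An orthogonal eigenbasis of the Gram matrix: \<open>u\<close> has eigenvalue 1 +
    2x, while \<open>v\<close> and \<open>w\<close> span the eigenspace of 1 - x.\<close>
  define u v w where "u = Y5 + Y6 + Y7" and "v = Y5 - Y6" and "w = Y5 + Y6 - 2 *\<^sub>R Y7"
  have expand_K: "K u u = 3 + 6 * x" "K v v = 2 * (1 - x)" "K w w = 6 * (1 - x)"
    "K u v = 0" "K u w = 0" "K v w = 0" "K v u = 0" "K w u = 0" "K w v = 0"
    unfolding u_def v_def w_def
    by (simp_all add: ne bilinear_ladd[OF bil] bilinear_radd[OF bil] bilinear_lsub[OF bil]
        bilinear_rsub[OF bil] bilinear_lmul[OF bil] bilinear_rmul[OF bil] K_Y algebra_simps)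
  have nz: "K u u \<noteq> 0" "K v v \<noteq> 0" "K w w \<noteq> 0"
    using x by (auto simp: expand_K)
  then have dist: "u \<noteq> v" "u \<noteq> w" "v \<noteq> w"
    using expand_K by metis+
  have indep: "independent {u, v, w}"
    by (rule orthogonal_independent[OF bil]) (use nz expand_K in auto)
  have "dim (UNIV :: 'g set) = 3"
    using dim_span[of ?Y] dim_eq_card_independent[OF Y(2)] Y(3) ne by simp
  then have span: "span {u, v, w} = UNIV"
    using dist by (intro span_eq_UNIV_of_card indep) simp_all
  have signature: "has_signature K p q"
    if "P \<union> N = {u, v, w}" "P \<inter> N = {}" "card P = p" "card N = q"
      "\<forall>y\<in>P. K y y > 0" "\<forall>y\<in>N. K y y < 0" for P N
    unfolding has_signature_def
  proof (intro exI conjI)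
    show "finite P" "finite N"
      using that(1) by (metis finite.emptyI finite_insert finite_Un)+
    show "\<forall>y\<in>P \<union> N. \<forall>z\<in>P \<union> N. y \<noteq> z \<longrightarrow> K y z = 0"
      unfolding that(1) using expand_K by auto
    show "independent (P \<union> N)" "span (P \<union> N) = UNIV"
      unfolding that(1) by (fact indep span)+
  qed (use that in auto)
  have "has_signature K p q"
  proof -
    consider "p = 3" "q = 0" "x = 0" | "p = 1" "q = 2" "x = 2" | "p = 2" "q = 1" "x = - 2"
      using x by auto
    then show ?thesis
    proof cases
      case 1
      show ?thesis
        by (rule signature[of "{u, v, w}" "{}"]) (use 1 dist expand_K in auto)
    next
      case 2
      show ?thesis
        by (rule signature[of "{u}" "{v, w}"]) (use 2 dist expand_K in auto)
    next
      case 3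
      show ?thesis
        by (rule signature[of "{v, w}" "{u}"]) (use 3 dist expand_K in auto)
    qed
  qed
  moreover have "K Y5 Y5 = 1" "K Y6 Y6 = 1" "K Y7 Y7 = 1"
    by (simp_all add: K_Y)
  ultimately show ?thesis
    using inv that by blast
qed


section \<open>The rotated coframe\<close>

context coframe
begin

lemma sigma_minus_wedge_psi:
  "sigma1_minus E \<^bold>\<and> g2_psi phi = 0" "sigma2_minus E \<^bold>\<and> g2_psi phi = 0"
  "sigma3_minus E \<^bold>\<and> g2_psi phi = 0"
  by (simp_all add: g2_psi_phi sigma1_minus_def sigma2_minus_def sigma3_minus_def wedge_sort)

text \<open>Every term of psi except E^1234 has two vertical factors, and four vertical one-forms in
  a three-dimensional span have zero product.\<close>

lemma vertical_wedge_psi: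
  assumes "\<alpha> = a5 *\<^sub>R E 5 + a6 *\<^sub>R E 6 + a7 *\<^sub>R E 7" "\<beta> = b5 *\<^sub>R E 5 + b6 *\<^sub>R E 6 + b7 *\<^sub>R E 7"
  shows "(\<alpha> \<^bold>\<and> \<beta>) \<^bold>\<and> g2_psi phi = \<alpha> \<^bold>\<and> \<beta> \<^bold>\<and> E 1 \<^bold>\<and> E 2 \<^bold>\<and> E 3 \<^bold>\<and> E 4"
  by (simp add: assms g2_psi_phi wedge_sort)

lemma sigma_minus_wedge:
  "sigma1_minus E \<^bold>\<and> sigma1_minus E = - 2 *\<^sub>R (E 1 \<^bold>\<and> E 2 \<^bold>\<and> E 3 \<^bold>\<and> E 4)"
  "sigma2_minus E \<^bold>\<and> sigma2_minus E = - 2 *\<^sub>R (E 1 \<^bold>\<and> E 2 \<^bold>\<and> E 3 \<^bold>\<and> E 4)"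
  "sigma3_minus E \<^bold>\<and> sigma3_minus E = - 2 *\<^sub>R (E 1 \<^bold>\<and> E 2 \<^bold>\<and> E 3 \<^bold>\<and> E 4)"
  "sigma1_minus E \<^bold>\<and> sigma2_minus E = 0" "sigma2_minus E \<^bold>\<and> sigma1_minus E = 0"
  "sigma1_minus E \<^bold>\<and> sigma3_minus E = 0" "sigma3_minus E \<^bold>\<and> sigma1_minus E = 0"
  "sigma2_minus E \<^bold>\<and> sigma3_minus E = 0" "sigma3_minus E \<^bold>\<and> sigma2_minus E = 0"
  by (simp_all add: sigma1_minus_def sigma2_minus_def sigma3_minus_def wedge_sort scaleR_2)

text \<open>Multiplying by the missing vertical one-form gives \<open>vol\<close>.\<close>

lemma mixed_volume_nonzero:
  "E 6 \<^bold>\<and> E 7 \<^bold>\<and> E 1 \<^bold>\<and> E 2 \<^bold>\<and> E 3 \<^bold>\<and> E 4 \<noteq> 0"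
  "E 7 \<^bold>\<and> E 5 \<^bold>\<and> E 1 \<^bold>\<and> E 2 \<^bold>\<and> E 3 \<^bold>\<and> E 4 \<noteq> 0"
  "E 5 \<^bold>\<and> E 6 \<^bold>\<and> E 1 \<^bold>\<and> E 2 \<^bold>\<and> E 3 \<^bold>\<and> E 4 \<noteq> 0"
proof -
  have vol: "vol \<noteq> 0"
    using vol_frame by (metis zero_fun_apply zero_neq_one)
  have "E 5 \<^bold>\<and> E 6 \<^bold>\<and> E 7 \<^bold>\<and> E 1 \<^bold>\<and> E 2 \<^bold>\<and> E 3 \<^bold>\<and> E 4 = vol"
    "E 6 \<^bold>\<and> E 7 \<^bold>\<and> E 5 \<^bold>\<and> E 1 \<^bold>\<and> E 2 \<^bold>\<and> E 3 \<^bold>\<and> E 4 = vol"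
    "E 7 \<^bold>\<and> E 5 \<^bold>\<and> E 6 \<^bold>\<and> E 1 \<^bold>\<and> E 2 \<^bold>\<and> E 3 \<^bold>\<and> E 4 = vol"
    by (simp_all add: vol_def wedge_sort)
  then show "E 6 \<^bold>\<and> E 7 \<^bold>\<and> E 1 \<^bold>\<and> E 2 \<^bold>\<and> E 3 \<^bold>\<and> E 4 \<noteq> 0"
    "E 7 \<^bold>\<and> E 5 \<^bold>\<and> E 1 \<^bold>\<and> E 2 \<^bold>\<and> E 3 \<^bold>\<and> E 4 \<noteq> 0"
    "E 5 \<^bold>\<and> E 6 \<^bold>\<and> E 1 \<^bold>\<and> E 2 \<^bold>\<and> E 3 \<^bold>\<and> E 4 \<noteq> 0"
    using vol by auto
qed

end

section \<open>Rotating the coframe and its dual frame\<close>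

definition adapted_coframe ::
    "(nat \<Rightarrow> ('v, real) form) \<Rightarrow> real ^ 3 ^ 3 \<Rightarrow> nat \<Rightarrow> ('v, real) form" where
  "adapted_coframe e B i = (if i = 5 then rotated_coframe e B 1 else if i = 6 then rotated_coframe e B 2
     else if i = 7 then rotated_coframe e B 3 else e i)"

text \<open>Dual frames transform by the inverse transpose, which for orthogonal \<open>B\<close> is
  \<open>B\<close> itself.\<close>

definition adapted_frame :: "(nat \<Rightarrow> 'v::real_vector) \<Rightarrow> real ^ 3 ^ 3 \<Rightarrow> nat \<Rightarrow> 'v" where
  "adapted_frame f B i =
     (let row = \<lambda>k. B $ k $ 1 *\<^sub>R f 5 + B $ k $ 2 *\<^sub>R f 6 + B $ k $ 3 *\<^sub>R f 7
      in if i = 5 then row 1 else if i = 6 then row 2 else if i = 7 then row 3 else f i)"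

lemma adapted_coframe_simps [simp]:
  "adapted_coframe e B 1 = e 1" "adapted_coframe e B 2 = e 2" "adapted_coframe e B 3 = e 3"
  "adapted_coframe e B 4 = e 4" "adapted_coframe e B 5 = rotated_coframe e B 1"
  "adapted_coframe e B 6 = rotated_coframe e B 2" "adapted_coframe e B 7 = rotated_coframe e B 3"
  by (simp_all add: adapted_coframe_def)

lemma orthogonal_rows_columns:
  fixes B :: "real ^ 3 ^ 3"
  assumes "orthogonal_matrix B"
  shows "B $ i $ 1 * B $ j $ 1 + B $ i $ 2 * B $ j $ 2 + B $ i $ 3 * B $ j $ 3 = (if i = j then 1 else 0)"
    and "B $ 1 $ i * B $ 1 $ j + B $ 2 $ i * B $ 2 $ j + B $ 3 $ i * B $ 3 $ j = (if i = j then 1 else 0)"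
proof -
  have "(B ** transpose B) $ i $ j = mat 1 $ i $ j" "(transpose B ** B) $ i $ j = mat 1 $ i $ j"
    using assms unfolding orthogonal_matrix_def by simp_all
  then show "B $ i $ 1 * B $ j $ 1 + B $ i $ 2 * B $ j $ 2 + B $ i $ 3 * B $ j $ 3 = (if i = j then 1 else 0)"
    "B $ 1 $ i * B $ 1 $ j + B $ 2 $ i * B $ 2 $ j + B $ 3 $ i * B $ 3 $ j = (if i = j then 1 else 0)"
    by (simp_all add: matrix_matrix_mult_def transpose_def mat_def sum_3)
qed

lemma (in coframe) coframe_adapted:
  assumes "orthogonal_matrix B"
  shows "coframe (adapted_coframe E B) (adapted_frame f B)"
proof
  show "dim (UNIV :: 'v set) = 7"
    by (rule dim7)
  show "adapted_coframe E B i \<in> forms 1" if "i \<in> {1..7}" for i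
    using that one_form unfolding adapted_coframe_def rotated_coframe_def
    by (auto intro!: forms_add forms_scaleR)
  have lin: "E i [x + y] = E i [x] + E i [y]" "E i [c *\<^sub>R x] = c * E i [x]" if "i \<in> {1..7}" for i x y c
    using linear_add[OF linear_coord[OF that]] linear_scale[OF linear_coord[OF that]] by simp_all
  have "rotated_coframe E B r [B $ s $ 1 *\<^sub>R f 5 + B $ s $ 2 *\<^sub>R f 6 + B $ s $ 3 *\<^sub>R f 7] =
      (if r = s then 1 else 0)" for r s
    using orthogonal_rows_columns(1)[OF assms, of r s]
    by (simp add: rotated_coframe_def lin dual)
  then show "adapted_coframe E B i [adapted_frame f B j] = (if i = j then 1 else 0)"
    if "i \<in> {1..7}" "j \<in> {1..7}" for i j
    using that unfolding index_cases
    by (elim disjE; hypsubst; simp add: adapted_frame_def Let_def)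
      (simp_all add: rotated_coframe_def lin dual)
qed

lemma rotated_coframe_inverse:
  assumes "orthogonal_matrix B"
  shows "e 5 = B $ 1 $ 1 *\<^sub>R rotated_coframe e B 1 + B $ 2 $ 1 *\<^sub>R rotated_coframe e B 2
      + B $ 3 $ 1 *\<^sub>R rotated_coframe e B 3"
    and "e 6 = B $ 1 $ 2 *\<^sub>R rotated_coframe e B 1 + B $ 2 $ 2 *\<^sub>R rotated_coframe e B 2
      + B $ 3 $ 2 *\<^sub>R rotated_coframe e B 3"
    and "e 7 = B $ 1 $ 3 *\<^sub>R rotated_coframe e B 1 + B $ 2 $ 3 *\<^sub>R rotated_coframe e B 2
      + B $ 3 $ 3 *\<^sub>R rotated_coframe e B 3"
proof -
  have "B $ 1 $ j *\<^sub>R rotated_coframe e B 1 + B $ 2 $ j *\<^sub>R rotated_coframe e B 2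
      + B $ 3 $ j *\<^sub>R rotated_coframe e B 3 =
    (B $ 1 $ j * B $ 1 $ 1 + B $ 2 $ j * B $ 2 $ 1 + B $ 3 $ j * B $ 3 $ 1) *\<^sub>R e 5 +
    (B $ 1 $ j * B $ 1 $ 2 + B $ 2 $ j * B $ 2 $ 2 + B $ 3 $ j * B $ 3 $ 2) *\<^sub>R e 6 +
    (B $ 1 $ j * B $ 1 $ 3 + B $ 2 $ j * B $ 2 $ 3 + B $ 3 $ j * B $ 3 $ 3) *\<^sub>R e 7" for j
    by (simp add: rotated_coframe_def fun_eq_iff algebra_simps)
  note this[unfolded orthogonal_rows_columns(2)[OF assms]]
  from this[of 1] this[of 2] this[of 3]
  show "e 5 = B $ 1 $ 1 *\<^sub>R rotated_coframe e B 1 + B $ 2 $ 1 *\<^sub>R rotated_coframe e B 2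
      + B $ 3 $ 1 *\<^sub>R rotated_coframe e B 3"
    "e 6 = B $ 1 $ 2 *\<^sub>R rotated_coframe e B 1 + B $ 2 $ 2 *\<^sub>R rotated_coframe e B 2
      + B $ 3 $ 2 *\<^sub>R rotated_coframe e B 3"
    "e 7 = B $ 1 $ 3 *\<^sub>R rotated_coframe e B 1 + B $ 2 $ 3 *\<^sub>R rotated_coframe e B 2
      + B $ 3 $ 3 *\<^sub>R rotated_coframe e B 3"
    by simp_all
qed

text \<open>Skew symmetry settles the remaining pairs of basis vectors, and linearity in one slot
  after the other extends the result to all vectors.\<close>

lemma abelian_lie_basis_iff:
  assumes lie: "lie_algebra lb" and Y: "distinct [Y5, Y6, Y7]" "independent {Y5, Y6, Y7}"
      "span {Y5, Y6, Y7} = UNIV"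
    and lb: "lb Y6 Y7 = lam5 *\<^sub>R Y5" "lb Y7 Y5 = lam6 *\<^sub>R Y6" "lb Y5 Y6 = lam7 *\<^sub>R Y7"
  shows "abelian_lie lb \<longleftrightarrow> lam5 = 0 \<and> lam6 = 0 \<and> lam7 = 0"
proof
  assume "abelian_lie lb"
  then have "lam5 *\<^sub>R Y5 = 0" "lam6 *\<^sub>R Y6 = 0" "lam7 *\<^sub>R Y7 = 0"
    using lb unfolding abelian_lie_def by simp_all
  moreover have "Y5 \<noteq> 0" "Y6 \<noteq> 0" "Y7 \<noteq> 0"
    using dependent_zero[of "{Y5, Y6, Y7}"] Y(2) by auto
  ultimately show "lam5 = 0 \<and> lam6 = 0 \<and> lam7 = 0"
    by simp
next
  assume zero: "lam5 = 0 \<and> lam6 = 0 \<and> lam7 = 0"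
  have bil: "bilinear lb" and alt: "lb x x = 0" for x
    using lie by (auto simp: lie_algebra_def)
  have swap: "lb y x = 0" if "lb x y = 0" for x y
    using lie_algebra_skew[OF lie, of y x] that by simp
  have lb0: "lb Y6 Y7 = 0" "lb Y7 Y5 = 0" "lb Y5 Y6 = 0"
    using zero lb by simp_all
  have basis: "lb x y = 0" if "x \<in> {Y5, Y6, Y7}" "y \<in> {Y5, Y6, Y7}" for x y
    using that lb0 lb0[THEN swap] alt by auto
  have lin: "linear (lb x)" "linear (\<lambda>x. lb x y)" for x y
    using bil by (auto simp: bilinear_def)
  have left: "lb x y = 0" if "y \<in> {Y5, Y6, Y7}" for x y
    by (rule linear_eq_0_on_span[OF lin(2), of "{Y5, Y6, Y7}"]) (use basis that Y(3) in auto)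
  show "abelian_lie lb"
    unfolding abelian_lie_def
  proof (intro allI)
    show "lb x y = 0" for x y
      by (rule linear_eq_0_on_span[OF lin(1), of "{Y5, Y6, Y7}"]) (use left Y(3) in auto)
  qed
qed

lemma wedge_by_scale_tensor: "wedge_by (\<lambda>y r. r *\<^sub>R y) (\<omega> \<^bold>\<otimes> y) \<eta> = (\<omega> \<^bold>\<and> \<eta>) \<^bold>\<otimes> y"
  by (simp add: wedge_by_def tensor_form_def fun_eq_iff scaleR_sum_left mult.commute)

lemma bilinear_scale: "bilinear (\<lambda>(y::'b::real_vector) (r::real). r *\<^sub>R y)"
  by (auto simp: bilinear_def intro!: linearI simp: algebra_simps)


section \<open>Instanton condition and heterotic system on the family\<close>

theorem proposition3p5:
  fixes br :: "'n::real_vector \<Rightarrow> 'n \<Rightarrow> 'n"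
    and e :: "nat \<Rightarrow> ('n, real) form"
    and \<epsilon>1 \<epsilon>2 \<epsilon>3 :: real
    and lb :: "'g::real_vector \<Rightarrow> 'g \<Rightarrow> 'g"
    and Y5 Y6 Y7 :: 'g
    and lam5 lam6 lam7 :: real
    and B :: "real ^ 3 ^ 3"
  assumes n: "lie_algebra br" "nilpotent_lie br" "dim (UNIV :: 'n set) = 7"
    and e: "dual_basis 7 e"
    and de: "\<forall>i\<in>{1..4}. ext_d br (e i) = 0"
      "ext_d br (e 5) = \<epsilon>1 *\<^sub>R sigma1_minus e"
      "ext_d br (e 6) = \<epsilon>2 *\<^sub>R sigma2_minus e"
      "ext_d br (e 7) = \<epsilon>3 *\<^sub>R sigma3_minus e"
    and g: "lie_algebra lb" "reductive_lie lb" "dim (UNIV :: 'g set) = 3"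
    and Y: "distinct [Y5, Y6, Y7]" "independent {Y5, Y6, Y7}" "span {Y5, Y6, Y7} = UNIV"
    and lb: "lb Y6 Y7 = lam5 *\<^sub>R Y5" "lb Y7 Y5 = lam6 *\<^sub>R Y6" "lb Y5 Y6 = lam7 *\<^sub>R Y7"
    and B: "rotation_matrix B"
  shows "g2_structure (phi_family e B) \<and>
    (g2_instanton br lb (phi_family e B) (connection_form e Y5 Y6 Y7) \<longleftrightarrow> abelian_lie lb) \<and>
    (abelian_lie lb \<longrightarrow> purely_co_closed br (phi_family e B)) \<and>
    (abelian_lie lb \<longrightarrow> (\<forall>(p, q)\<in>{(3, 0), (1, 2), (2, 1)}. \<exists>K.
       invariant_pairing lb K \<and> has_signature K p q \<and>
       heterotic_bianchi br lb K (phi_family e B) (connection_form e Y5 Y6 Y7) \<and>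
       heterotic_g2_system br lb K (phi_family e B) (connection_form e Y5 Y6 Y7)))"
proof -
  have orth: "orthogonal_matrix B"
    using B by (simp add: rotation_matrix_def)
  obtain f where coframe_e: "coframe e f"
    using dual_basis_frame[OF e n(3)] by blast
  interpret e: coframe e f
    by (rule coframe_e)
  define E where "E = adapted_coframe e B"
  \<comment> \<open>\<open>C\<close> is \<open>B\<close> times the diagonal matrix of the
    \<open>\<epsilon>\<close>'s: row i of \<open>B\<close> combines the three structure
    equations.\<close>
  define C :: "real ^ 3 ^ 3" where "C = (\<chi> i j. B $ i $ j * vector [\<epsilon>1, \<epsilon>2, \<epsilon>3] $ j)"
  have E: "E 1 = e 1" "E 2 = e 2" "E 3 = e 3" "E 4 = e 4" "E 5 = rotated_coframe e B 1"
    "E 6 = rotated_coframe e B 2" "E 7 = rotated_coframe e B 3"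
    unfolding E_def by (rule adapted_coframe_simps)+
  have sigma: "sigma1_minus E = sigma1_minus e" "sigma2_minus E = sigma2_minus e"
    "sigma3_minus E = sigma3_minus e"
    by (simp_all only: sigma1_minus_def sigma2_minus_def sigma3_minus_def E)
  have d_rotated: "ext_d br (rotated_coframe e B i) =
      C $ i $ 1 *\<^sub>R sigma1_minus e + C $ i $ 2 *\<^sub>R sigma2_minus e + C $ i $ 3 *\<^sub>R sigma3_minus e" for i
    by (simp add: rotated_coframe_def ext_d_add ext_d_scaleR de C_def)
  interpret E: nilpotent_coframe E "adapted_frame f B" br C
  proof (intro nilpotent_coframe.intro nilpotent_coframe_axioms.intro)
    show "coframe E (adapted_frame f B)"
      unfolding E_def by (rule e.coframe_adapted[OF orth])
    show "ext_d br (E i) = 0" if "i \<in> {1..4}" for i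
      using that de(1) by (auto simp: E_def adapted_coframe_def)
  qed (simp_all only: E sigma d_rotated)
  have phi: "phi_family e B = E.phi"
    unfolding phi_family_def Let_def sigma1_plus_def sigma2_plus_def sigma3_plus_def E.phi_def E
    by (simp add: algebra_simps)
  let ?A = "connection_form e Y5 Y6 Y7"
  let ?\<nu> = "e 1 \<^bold>\<and> e 2 \<^bold>\<and> e 3 \<^bold>\<and> e 4"
  have curvature: "curvature br lb ?A =
      (\<epsilon>1 *\<^sub>R sigma1_minus e + lam5 *\<^sub>R (e 6 \<^bold>\<and> e 7)) \<^bold>\<otimes> Y5 +
      (\<epsilon>2 *\<^sub>R sigma2_minus e + lam6 *\<^sub>R (e 7 \<^bold>\<and> e 5)) \<^bold>\<otimes> Y6 +
      (\<epsilon>3 *\<^sub>R sigma3_minus e + lam7 *\<^sub>R (e 5 \<^bold>\<and> e 6)) \<^bold>\<otimes> Y7"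
    by (subst curvature_connection_form[OF g(1) _ _ _ lb]) (simp_all add: e.one_form de)
  note psi_sigma = E.sigma_minus_wedge_psi[unfolded sigma]
  \<comment> \<open>Writing e^5, e^6, e^7 in the rotated coframe makes their products vertical
    there, as \<open>vertical_wedge_psi\<close> requires.\<close>
  note inverse = rotated_coframe_inverse[OF orth, of e, folded E]
  note vertical = E.vertical_wedge_psi[unfolded E(1-4)]
  have psi: "(\<epsilon>1 *\<^sub>R sigma1_minus e + lam5 *\<^sub>R (e 6 \<^bold>\<and> e 7)) \<^bold>\<and> g2_psi E.phi = lam5 *\<^sub>R (e 6 \<^bold>\<and> e 7 \<^bold>\<and> ?\<nu>)"
    "(\<epsilon>2 *\<^sub>R sigma2_minus e + lam6 *\<^sub>R (e 7 \<^bold>\<and> e 5)) \<^bold>\<and> g2_psi E.phi = lam6 *\<^sub>R (e 7 \<^bold>\<and> e 5 \<^bold>\<and> ?\<nu>)"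
    "(\<epsilon>3 *\<^sub>R sigma3_minus e + lam7 *\<^sub>R (e 5 \<^bold>\<and> e 6)) \<^bold>\<and> g2_psi E.phi = lam7 *\<^sub>R (e 5 \<^bold>\<and> e 6 \<^bold>\<and> ?\<nu>)"
    unfolding wedge_add_left wedge_scaleR_left psi_sigma vertical[OF inverse(2,3)]
      vertical[OF inverse(3,1)] vertical[OF inverse(1,2)] by simp_all
  have F_psi: "wedge_by (\<lambda>y r. r *\<^sub>R y) (curvature br lb ?A) (g2_psi E.phi) =
      (lam5 *\<^sub>R (e 6 \<^bold>\<and> e 7 \<^bold>\<and> ?\<nu>)) \<^bold>\<otimes> Y5 + (lam6 *\<^sub>R (e 7 \<^bold>\<and> e 5 \<^bold>\<and> ?\<nu>)) \<^bold>\<otimes> Y6 +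
      (lam7 *\<^sub>R (e 5 \<^bold>\<and> e 6 \<^bold>\<and> ?\<nu>)) \<^bold>\<otimes> Y7"
    unfolding curvature wedge_by_add(1)[OF bilinear_scale] wedge_by_scale_tensor psi ..
  have abelian_iff: "abelian_lie lb \<longleftrightarrow> lam5 = 0 \<and> lam6 = 0 \<and> lam7 = 0"
    by (rule abelian_lie_basis_iff[OF g(1) Y lb])
  have instanton_iff: "g2_instanton br lb E.phi ?A \<longleftrightarrow> abelian_lie lb"
  proof
    assume "g2_instanton br lb E.phi ?A"
    then have "lam5 *\<^sub>R (e 6 \<^bold>\<and> e 7 \<^bold>\<and> ?\<nu>) = 0" "lam6 *\<^sub>R (e 7 \<^bold>\<and> e 5 \<^bold>\<and> ?\<nu>) = 0"
      "lam7 *\<^sub>R (e 5 \<^bold>\<and> e 6 \<^bold>\<and> ?\<nu>) = 0"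
      unfolding g2_instanton_def F_psi by (rule tensor_basis_eq_0[OF Y(1,2)])+
    \<comment> \<open>The three 6-forms are nonzero, so the structure constants have to
      vanish.\<close>
    then show "abelian_lie lb"
      unfolding abelian_iff scaleR_eq_0_iff using e.mixed_volume_nonzero by blast
  next
    assume "abelian_lie lb"
    then show "g2_instanton br lb E.phi ?A"
      unfolding g2_instanton_def F_psi abelian_iff by (simp add: tensor_zero)
  qed
  have "(\<Sum>i\<in>UNIV. \<Sum>j\<in>UNIV. (C $ i $ j)\<^sup>2) =
      (B $ 1 $ 1 * B $ 1 $ 1 + B $ 2 $ 1 * B $ 2 $ 1 + B $ 3 $ 1 * B $ 3 $ 1) * \<epsilon>1\<^sup>2 +
      (B $ 1 $ 2 * B $ 1 $ 2 + B $ 2 $ 2 * B $ 2 $ 2 + B $ 3 $ 2 * B $ 3 $ 2) * \<epsilon>2\<^sup>2 +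
      (B $ 1 $ 3 * B $ 1 $ 3 + B $ 2 $ 3 * B $ 2 $ 3 + B $ 3 $ 3 * B $ 3 $ 3) * \<epsilon>3\<^sup>2"
    by (simp add: sum_3 C_def power2_eq_square algebra_simps)
  \<comment> \<open>The columns of \<open>B\<close> are unit vectors, so the rotation drops out of
    dT.\<close>
  then have C_norm: "(\<Sum>i\<in>UNIV. \<Sum>j\<in>UNIV. (C $ i $ j)\<^sup>2) = \<epsilon>1\<^sup>2 + \<epsilon>2\<^sup>2 + \<epsilon>3\<^sup>2"
    unfolding orthogonal_rows_columns(2)[OF orth] by simp
  have bianchi: "heterotic_bianchi br lb K E.phi ?A"
    if ab: "abelian_lie lb" and K: "invariant_pairing lb K" "K Y5 Y5 = 1" "K Y6 Y6 = 1" "K Y7 Y7 = 1" for K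
  proof -
    have bil: "bilinear K"
      using K(1) by (simp add: invariant_pairing_def)
    \<comment> \<open>Mixed products sigma_i^- wedge sigma_j^- vanish, so the off-diagonal values of
      \<open>K\<close> do not enter.\<close>
    have "wedge_by K (curvature br lb ?A) (curvature br lb ?A) =
        (- 2 * (\<epsilon>1\<^sup>2 + \<epsilon>2\<^sup>2 + \<epsilon>3\<^sup>2)) *\<^sub>R ?\<nu>"
      using ab unfolding curvature abelian_iff
      by (simp add: wedge_by_add[OF bil] wedge_by_tensor[OF bil] e.sigma_minus_wedge K(2-4)
          tensor_zero)
        (simp add: tensor_form_def fun_eq_iff power2_eq_square algebra_simps)
    then show ?thesis
      unfolding heterotic_bianchi_def E.ext_d_torsion C_norm E by simp
  qed
  show ?thesis
    unfolding phi
  proof (intro conjI impI)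
    show "g2_structure E.phi"
      by (rule E.g2_structure_phi)
    show "g2_instanton br lb E.phi ?A \<longleftrightarrow> abelian_lie lb"
      by (rule instanton_iff)
    show "purely_co_closed br E.phi"
      by (rule E.purely_co_closed_phi)
    assume ab: "abelian_lie lb"
    have "\<exists>K. invariant_pairing lb K \<and> has_signature K p q \<and> heterotic_bianchi br lb K E.phi ?A \<and>
        heterotic_g2_system br lb K E.phi ?A" if pq: "(p, q) \<in> {(3, 0), (1, 2), (2, 1)}" for p q
    proof -
      obtain K where K: "invariant_pairing lb K" "has_signature K p q"
          "K Y5 Y5 = 1" "K Y6 Y6 = 1" "K Y7 Y7 = 1"
        by (rule pairing_exists[OF Y ab pq])
      have "heterotic_bianchi br lb K E.phi ?A"
        by (rule bianchi[OF ab K(1,3-5)])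
      \<comment> \<open>Both sides of the equation for d psi are zero, since tau_1 vanishes.\<close>
      moreover have "heterotic_g2_system br lb K E.phi ?A"
        unfolding heterotic_g2_system_def E.ext_d_psi E.tau1_phi
        using E.g2_structure_phi K(1) instanton_iff ab calculation by simp
      ultimately show ?thesis
        using K(1,2) by blast
    qed
    then show "\<forall>(p, q)\<in>{(3, 0), (1, 2), (2, 1)}. \<exists>K. invariant_pairing lb K \<and> has_signature K p q \<and>
        heterotic_bianchi br lb K E.phi ?A \<and> heterotic_g2_system br lb K E.phi ?A"
      by blast
  qed
qed

end
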